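(* Let $a>1$. (i) Let $m\in\mathbb{N}^*=\{1,2,\dots\}$ and $\alpha=-2(m-1)$. Let $u_t$ be a given real-valued function in $L^2(\mathcal{C}_a)$, and let $u_n$ be a real-valued function in $L^2(\mathcal{C}_a)$ such that the global relation $$\int_{\mathcal{C}_a}\big[(k-z)(k+\bar z)\big]^{\alpha/2-1}\big((k-iy)u_t(z)+ix\,u_n(z)\big)\,ds=0,\qquad k\in\mathbb{C}\setminus(\overline{\mathcal{D}_a}\cup\overline{\mathcal{D}_{-a}}),\qquad(\ast)$$ holds true. Then $u_n$ is unique (i.e. uniquely determined by $u_t$ and $(\ast)$) and can be explicitly recovered from that relation. (ii) Let $m\in\mathbb{N}=\{0,1,2,\dots\}$ and $\alpha=2(m+1)$. In this case, the relation $(\ast)$ (with this value of $\alpha$) does not allow the reconstruction of $u_n$, i.e. it does not determine $u_n$ from $u_t$. However, a statement similar to (i) holds with another relation: let $u$ be a given real-valued function on $\mathcal{C}_a$ with tangential derivative $u_t\in L^2(\mathcal{C}_a)$, and let $u_n$ be a real-valued function in $L^2(\mathcal{C}_a)$ such that $$\int_{\mathcal{C}_a}\frac{x^{\alpha-2}}{\big[(k-z)(k+\bar z)\big]^{\alpha/2}}\Big\{2x\big((k-iy)u_t(z)+ix\,u_n(z)\big)ds+(\alpha-1)u(z)\big[(k+\bar z)dz+(k-z)d\bar z\big]\Big\}=0$$ for all $k\in\mathbb{C}\setminus(\overline{\mathcal{D}_a}\cup\overline{\mathcal{D}_{-a}})$. Then $u_n$ is unique and can be explicitly recovered from that relation.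
   Context: Write $z=x+iy$. $\mathcal{D}_{a}=D(a,1)$ and $\mathcal{D}_{-a}=D(-a,1)$ are the open disks of radius $1$ centered at the real points $a>1$ and $-a$; $\mathcal{C}_a=C(a,1)$ is the boundary circle of $\mathcal{D}_a$, oriented counter-clockwise, with length element $ds$. The functions $u_t$ and $u_n$ play the role of the tangential (counter-clockwise) and outer normal derivatives on $\mathcal{C}_a$ of a solution $u$ of $\Delta u+\frac{\alpha}{x}\partial_xu=0$ in $\mathcal{D}_a$. In (ii), the relation is the vanishing of the integral over $\mathcal{C}_a$ of the differential form $$\big[(k-z)(k+\bar z)\big]^{-\alpha/2}x^{\alpha-2}\Big[(k+\bar z)\big(2xu_z+(\alpha-1)u\big)dz+(k-z)\big(2xu_{\bar z}+(\alpha-1)u\big)d\bar z\Big],$$ in which on $\mathcal{C}_a$ one substitutes $u_z\,dz=\frac12(u_t+iu_n)ds$ and $u_{\bar z}\,d\bar z=\frac12(u_t-iu_n)ds$. *)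

theory Defs
  imports "HOL-Analysis.Analysis"
begin

section \<open>The circle and its function spaces\<close>

text \<open>Only the values of a function on the circle matter: the underlying space of
  \<open>arc_length a\<close> is the circle \<open>sphere (of_real a) 1\<close> itself, with its Borel sets.\<close>

definition arc_length :: "real \<Rightarrow> complex measure" where
  "arc_length a =
     distr (restrict_space lborel {0..<2 * pi})
           (restrict_space borel (sphere (complex_of_real a) 1))
           (\<lambda>\<theta>. complex_of_real a + cis \<theta>)"

definition L2_circle :: "real \<Rightarrow> (complex \<Rightarrow> real) \<Rightarrow> bool" where
  "L2_circle a f \<longleftrightarrow>
     f \<in> borel_measurable (arc_length a) \<and> integrable (arc_length a) (\<lambda>z. (f z)\<^sup>2)"

definition L2_circle_tendsto ::
    "real \<Rightarrow> (nat \<Rightarrow> complex \<Rightarrow> complex) \<Rightarrow> (complex \<Rightarrow> real) \<Rightarrow> bool" where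
  "L2_circle_tendsto a F f \<longleftrightarrow>
     (\<forall>N. integrable (arc_length a) (\<lambda>z. (cmod (F N z - of_real (f z)))\<^sup>2)) \<and>
     (\<lambda>N. LINT z|arc_length a. (cmod (F N z - of_real (f z)))\<^sup>2) \<longlonglongrightarrow> 0"

text \<open>\<open>u\<close> has the square integrable counter-clockwise tangential derivative \<open>ut\<close>: along the
  arc length parameter, \<open>u\<close> is absolutely continuous with almost everywhere derivative \<open>ut\<close>.
  The endpoint \<open>\<theta> = 2 * pi\<close> makes \<open>u\<close> continuous across the base point \<open>a + 1\<close>.\<close>

definition has_tangential_derivative ::
    "real \<Rightarrow> (complex \<Rightarrow> real) \<Rightarrow> (complex \<Rightarrow> real) \<Rightarrow> bool" where
  "has_tangential_derivative a u ut \<longleftrightarrow>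
     L2_circle a ut \<and>
     (\<forall>\<theta>\<in>{0..2 * pi}. u (complex_of_real a + cis \<theta>) =
        u (complex_of_real a + 1) + (LINT s:{0..\<theta>}|lborel. ut (complex_of_real a + cis s)))"

text \<open>Densities of \<open>dz\<close> and of its conjugate with respect to arc length, for the
  counter-clockwise orientation.\<close>

definition dz_ds :: "real \<Rightarrow> complex \<Rightarrow> complex" where
  "dz_ds a z = \<i> * (z - of_real a)"

definition dzbar_ds :: "real \<Rightarrow> complex \<Rightarrow> complex" where
  "dzbar_ds a z = cnj (dz_ds a z)"


section \<open>The global relations\<close>

definition exterior_domain :: "real \<Rightarrow> complex set" where
  "exterior_domain a = UNIV - (cball (complex_of_real a) 1 \<union> cball (complex_of_real (- a)) 1)"

text \<open>The parameter \<open>\<alpha>\<close> is an even integer throughout, so that \<open>\<alpha> div 2\<close> is exact and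
  all powers have integer exponents; no branch of a complex power is involved.\<close>

definition kern :: "complex \<Rightarrow> complex \<Rightarrow> complex" where
  "kern k z = (k - z) * (k + cnj z)"

definition global_relation ::
    "real \<Rightarrow> int \<Rightarrow> (complex \<Rightarrow> real) \<Rightarrow> (complex \<Rightarrow> real) \<Rightarrow> bool" where
  "global_relation a \<alpha> ut un \<longleftrightarrow>
     (\<forall>k\<in>exterior_domain a.
        (LINT z|arc_length a. kern k z powi (\<alpha> div 2 - 1) *
           ((k - \<i> * of_real (Im z)) * of_real (ut z) + \<i> * of_real (Re z) * of_real (un z))) = 0)"

definition global_relation' ::
    "real \<Rightarrow> int \<Rightarrow> (complex \<Rightarrow> real) \<Rightarrow> (complex \<Rightarrow> real) \<Rightarrow> (complex \<Rightarrow> real) \<Rightarrow> bool" where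
  "global_relation' a \<alpha> u ut un \<longleftrightarrow>
     (\<forall>k\<in>exterior_domain a.
        (LINT z|arc_length a. of_real (Re z) powi (\<alpha> - 2) / kern k z powi (\<alpha> div 2) *
           (2 * of_real (Re z) *
              ((k - \<i> * of_real (Im z)) * of_real (ut z) + \<i> * of_real (Re z) * of_real (un z))
            + of_int (\<alpha> - 1) * of_real (u z) *
              ((k + cnj z) * dz_ds a z + (k - z) * dzbar_ds a z))) = 0)"


section \<open>The explicit inversion formula\<close>

text \<open>Both relations express, for a suitable real function \<open>g\<close> built from \<open>un\<close>, the integral
  \<open>\<Phi> k = LINT z|arc_length a. x * g z / kern k z ^ M\<close> in terms of the given data, and \<open>g\<close> is
  recovered from \<open>\<Phi>\<close> as follows.  Put \<open>c = sqrt (a\<^sup>2 - 1)\<close>, \<open>r = a - c\<close>, and apply the Moebius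
  map \<open>(z - c) / (z + c)\<close>; it maps the circle onto \<open>{r * cis \<phi>}\<close>, with
  \<open>ds = (x / c) d\<phi>\<close>, and the points \<open>k = c * (1 + \<kappa>) / (1 - \<kappa>)\<close> with \<open>\<kappa> = cis \<psi> \<noteq> 1\<close> are the
  points of the imaginary axis.  There
  \<open>c * (2 * \<kappa> / (r * (1 - \<kappa>)\<^sup>2)) ^ M * \<Phi> k\<close> equals the convolution over \<open>{0..2 * pi}\<close> of
  \<open>G = x powi (2 - M) * g\<close>, as a function of \<open>\<phi>\<close>, with \<open>1 / cmod (cis \<psi> - r) ^ (2 * M)\<close>.  The
  \<open>n\<close>-th Fourier coefficient of the latter is \<open>poisson_coeff a M n > 0\<close>, by the binomial
  series, so the Fourier coefficients of \<open>G\<close> are obtained by division.\<close>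

definition focus :: "real \<Rightarrow> real" where
  "focus a = sqrt (a\<^sup>2 - 1)"

definition radius :: "real \<Rightarrow> real" where
  "radius a = a - focus a"

definition poisson_coeff :: "real \<Rightarrow> nat \<Rightarrow> int \<Rightarrow> real" where
  "poisson_coeff a M n =
     (\<Sum>q. real ((M - 1 + q) choose q) * real ((M - 1 + q + nat \<bar>n\<bar>) choose (q + nat \<bar>n\<bar>)) *
           radius a ^ (2 * q + nat \<bar>n\<bar>))"

definition inversion_coeff :: "real \<Rightarrow> nat \<Rightarrow> (complex \<Rightarrow> complex) \<Rightarrow> int \<Rightarrow> complex" where
  "inversion_coeff a M \<Phi> n =
     (LINT \<psi>:{0..2 * pi}|lborel.
        of_real (focus a) * (2 * cis \<psi> / (of_real (radius a) * (1 - cis \<psi>)\<^sup>2)) ^ M *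
        \<Phi> (of_real (focus a) * (1 + cis \<psi>) / (1 - cis \<psi>)) * cis (- of_int n * \<psi>))
     / of_real (4 * pi\<^sup>2 * poisson_coeff a M n)"

definition inversion_series ::
    "real \<Rightarrow> nat \<Rightarrow> (complex \<Rightarrow> complex) \<Rightarrow> nat \<Rightarrow> complex \<Rightarrow> complex" where
  "inversion_series a M \<Phi> N z =
     of_real (Re z) powi (int M - 2) *
     (\<Sum>n = - int N..int N. inversion_coeff a M \<Phi> n *
        ((z - of_real (focus a)) / (of_real (radius a) * (z + of_real (focus a)))) powi n)"

text \<open>The values of \<open>\<Phi>\<close> supplied by the two relations: for \<open>global_relation\<close> with
  \<open>\<alpha> = - 2 * (m - 1)\<close> one has \<open>M = m\<close> and \<open>g = un\<close>; for \<open>global_relation'\<close> with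
  \<open>\<alpha> = 2 * (m + 1)\<close> one has \<open>M = m + 1\<close> and \<open>g = x powi (\<alpha> - 1) * un\<close>.\<close>

definition relation_data :: "real \<Rightarrow> int \<Rightarrow> (complex \<Rightarrow> real) \<Rightarrow> complex \<Rightarrow> complex" where
  "relation_data a \<alpha> ut k =
     \<i> * (LINT z|arc_length a. kern k z powi (\<alpha> div 2 - 1) *
            ((k - \<i> * of_real (Im z)) * of_real (ut z)))"

definition relation_data' ::
    "real \<Rightarrow> int \<Rightarrow> (complex \<Rightarrow> real) \<Rightarrow> (complex \<Rightarrow> real) \<Rightarrow> complex \<Rightarrow> complex" where
  "relation_data' a \<alpha> u ut k =
     \<i> / 2 * (LINT z|arc_length a. of_real (Re z) powi (\<alpha> - 2) / kern k z powi (\<alpha> div 2) *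
            (2 * of_real (Re z) * ((k - \<i> * of_real (Im z)) * of_real (ut z))
             + of_int (\<alpha> - 1) * of_real (u z) *
               ((k + cnj z) * dz_ds a z + (k - z) * dzbar_ds a z)))"

definition recovered_normal_derivative ::
    "real \<Rightarrow> nat \<Rightarrow> (complex \<Rightarrow> real) \<Rightarrow> nat \<Rightarrow> complex \<Rightarrow> complex" where
  "recovered_normal_derivative a m ut N z =
     inversion_series a m (relation_data a (- 2 * (int m - 1)) ut) N z"

definition recovered_normal_derivative' ::
    "real \<Rightarrow> nat \<Rightarrow> (complex \<Rightarrow> real) \<Rightarrow> (complex \<Rightarrow> real) \<Rightarrow> nat \<Rightarrow> complex \<Rightarrow> complex" where
  "recovered_normal_derivative' a m u ut N z =
     inversion_series a (m + 1) (relation_data' a (2 * (int m + 1)) u ut) N z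
     / of_real (Re z) powi (2 * int m + 1)"

end

theory Submission
  imports Defs
begin

text \<open>Each of the two relations prescribes, for \<open>k\<close> in the exterior domain, the transform
  \<open>\<Phi> k = LINT z|arc_length a. x * g z / kern k z ^ M\<close> of an unknown real function \<open>g\<close> (\<open>un\<close>
  itself, or \<open>un\<close> times a power of \<open>x = Re z\<close>) by the given data
  (\<open>relation_data_eq\<close>, \<open>relation_data'_eq\<close>).  So everything rests on inverting
  \<open>g \<mapsto> \<Phi>\<close>, which becomes a deconvolution once \<open>\<Phi>\<close> is looked at on the imaginary axis
  only.

  With \<open>c = sqrt (a\<^sup>2 - 1)\<close>, the points \<open>c\<close> and \<open>- c\<close> are inverse to each other with
  respect to the circle and mirror images in the imaginary axis.  Hence
  \<open>w = (z - c) / (z + c)\<close> maps the circle onto a circle \<open>cmod w = r\<close> with \<open>r < 1\<close>, the imaginary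
  axis onto the unit circle, and in these coordinates \<open>kern k z\<close> is, up to a factor depending
  on \<open>k\<close> alone, \<open>x * (cmod (\<kappa> - w))\<^sup>2\<close> (\<open>kern_cayley_point\<close>).  With \<open>w = r * v\<close>, the transform
  is therefore the convolution of \<open>G = x powi (2 - M) * g\<close>, as a function of the angle of \<open>v\<close>,
  with \<open>1 / cmod (\<kappa> - r) ^ (2 * M)\<close>.  By the negative binomial series, all Fourier coefficients
  of this kernel are positive (\<open>poisson_integral\<close>, \<open>poisson_coeff_pos\<close>), and division by them
  gives the Fourier coefficients of \<open>G\<close> (\<open>inversion_coeff_eq\<close>).  Convergence of Fourier series
  in the mean then recovers \<open>g\<close> (\<open>inversion_series_tendsto\<close>).  Uniqueness is a consequence: the
  approximating sequence depends on the data only, and a limit in the mean is determined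
  almost everywhere (\<open>L2_circle_tendsto_unique\<close>).

  The Fourier analysis stays on the original circle.  There \<open>v\<close> has modulus \<open>1\<close>, and the
  measure \<open>(c / x) ds\<close>, which is the angular measure of \<open>v\<close>, makes its powers orthogonal
  (\<open>unitary_coordinate_disk_coord\<close>).  Orthogonality and the fact that \<open>v\<close> generates the sigma
  algebra are all that completeness of the powers uses; the locale
  \<open>unitary_coordinate\<close> isolates this.

  For \<open>\<alpha> = 2 * (m + 1)\<close>, the kernel of the first relation is the polynomial \<open>kern k z ^ m\<close>.  On
  the circle it is a trigonometric polynomial of degree \<open>m\<close> in the angle around the
  centre \<open>a\<close>, because \<open>kern k z\<close> has degree \<open>1\<close>; multiplied by \<open>x\<close> it has degree \<open>m + 1\<close>.  So
  adding the harmonic of order \<open>m + 2\<close> to \<open>un\<close> does not change the relation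
  (\<open>silent_mode_annihilated\<close>), and \<open>un\<close> is not determined.\<close>


section \<open>Laurent polynomials on the unit circle\<close>

definition laurent_sum :: "(int \<Rightarrow> complex) \<Rightarrow> nat \<Rightarrow> complex \<Rightarrow> complex" where
  "laurent_sum d N v = (\<Sum>n = - int N..int N. d n * v powi n)"

text \<open>Only values on the unit circle count.  There the real polynomials in \<open>Re v\<close> and \<open>Im v\<close> are of
  this form, since \<open>cnj v = 1 / v\<close>, and this is how the Stone-Weierstrass theorem applies.\<close>

definition laurent_poly :: "(complex \<Rightarrow> complex) \<Rightarrow> bool" where
  "laurent_poly p \<longleftrightarrow> (\<exists>N d. \<forall>v. cmod v = 1 \<longrightarrow> p v = laurent_sum d N v)"

lemma laurent_sum_extend:
  assumes "N \<le> N'"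
  shows "laurent_sum d N v = laurent_sum (\<lambda>n. if \<bar>n\<bar> \<le> int N then d n else 0) N' v"
  unfolding laurent_sum_def
  using assms by (intro sum.mono_neutral_cong_left) auto

lemma laurent_polyI: "(\<And>v. cmod v = 1 \<Longrightarrow> p v = laurent_sum d N v) \<Longrightarrow> laurent_poly p"
  unfolding laurent_poly_def by blast

lemma laurent_poly_cong:
  "laurent_poly p \<Longrightarrow> (\<And>v. cmod v = 1 \<Longrightarrow> q v = p v) \<Longrightarrow> laurent_poly q"
  unfolding laurent_poly_def by metis

lemma laurent_poly_powi: "laurent_poly (\<lambda>v. v powi j)"
proof (rule laurent_polyI)
  show "v powi j = laurent_sum (\<lambda>n. if n = j then 1 else 0) (nat \<bar>j\<bar>) v" for v
  proof -
    have "(\<Sum>n = - \<bar>j\<bar>..\<bar>j\<bar>. (if n = j then 1 else 0) * v powi n)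
        = (\<Sum>n = - \<bar>j\<bar>..\<bar>j\<bar>. if n = j then v powi n else 0)"
      by (rule sum.cong) auto
    also have "\<dots> = v powi j"
      using abs_ge_self[of j] abs_ge_minus_self[of j] by (simp add: minus_le_iff)
    finally show ?thesis by (simp add: laurent_sum_def)
  qed
qed

lemma laurent_poly_add:
  assumes "laurent_poly p" "laurent_poly q"
  shows "laurent_poly (\<lambda>v. p v + q v)"
proof -
  obtain N d where p: "\<And>v. cmod v = 1 \<Longrightarrow> p v = laurent_sum d N v"
    using assms(1) unfolding laurent_poly_def by blast
  obtain K e where q: "\<And>v. cmod v = 1 \<Longrightarrow> q v = laurent_sum e K v"
    using assms(2) unfolding laurent_poly_def by blast
  define d' where "d' = (\<lambda>n. if \<bar>n\<bar> \<le> int N then d n else 0)"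
  define e' where "e' = (\<lambda>n. if \<bar>n\<bar> \<le> int K then e n else 0)"
  show ?thesis
  proof (rule laurent_polyI)
    fix v :: complex assume v: "cmod v = 1"
    have "p v = laurent_sum d' (max N K) v" "q v = laurent_sum e' (max N K) v"
      using p[OF v] q[OF v] laurent_sum_extend[of N "max N K" d v]
        laurent_sum_extend[of K "max N K" e v] by (auto simp: d'_def e'_def)
    then show "p v + q v = laurent_sum (\<lambda>n. d' n + e' n) (max N K) v"
      by (simp add: laurent_sum_def sum.distrib distrib_right)
  qed
qed

lemma laurent_poly_cmult:
  assumes "laurent_poly p"
  shows "laurent_poly (\<lambda>v. c * p v)"
proof -
  obtain N d where p: "\<And>v. cmod v = 1 \<Longrightarrow> p v = laurent_sum d N v"
    using assms unfolding laurent_poly_def by blast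
  show ?thesis
    by (rule laurent_polyI[of _ "\<lambda>n. c * d n" N])
       (simp add: p laurent_sum_def sum_distrib_left mult.assoc)
qed

lemma laurent_poly_const: "laurent_poly (\<lambda>v. c)"
  using laurent_poly_cmult[OF laurent_poly_powi[of 0], of c] by simp

lemma laurent_poly_sum:
  assumes "finite I" "\<And>i. i \<in> I \<Longrightarrow> laurent_poly (f i)"
  shows "laurent_poly (\<lambda>v. \<Sum>i\<in>I. f i v)"
  using assms
proof (induction I rule: finite_induct)
  case empty
  show ?case using laurent_poly_const[of 0] by simp
next
  case (insert i I)
  then have "laurent_poly (\<lambda>v. f i v + (\<Sum>i\<in>I. f i v))"
    by (intro laurent_poly_add) auto
  with insert.hyps show ?case by simp
qed

lemma laurent_poly_mult:
  assumes "laurent_poly p" "laurent_poly q"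
  shows "laurent_poly (\<lambda>v. p v * q v)"
proof -
  obtain N d where p: "\<And>v. cmod v = 1 \<Longrightarrow> p v = laurent_sum d N v"
    using assms(1) unfolding laurent_poly_def by blast
  obtain K e where q: "\<And>v. cmod v = 1 \<Longrightarrow> q v = laurent_sum e K v"
    using assms(2) unfolding laurent_poly_def by blast
  have "laurent_poly (\<lambda>v. \<Sum>n = - int N..int N. \<Sum>k = - int K..int K. (d n * e k) * v powi (n + k))"
    by (intro laurent_poly_sum laurent_poly_cmult laurent_poly_powi) auto
  then show ?thesis
  proof (rule laurent_poly_cong)
    fix v :: complex assume v: "cmod v = 1"
    then have "v \<noteq> 0" by auto
    then show "p v * q v = (\<Sum>n = - int N..int N. \<Sum>k = - int K..int K. (d n * e k) * v powi (n + k))"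
      by (simp add: p[OF v] q[OF v] laurent_sum_def sum_product power_int_add mult_ac)
  qed
qed

lemma powi_minus_unit: "cmod v = 1 \<Longrightarrow> v powi (- n) = cnj (v powi n)"
proof -
  assume "cmod v = 1"
  then have "v powi n * cnj (v powi n) = 1"
    by (simp only: complex_norm_square[symmetric] norm_power_int) simp
  then show ?thesis by (metis inverse_unique power_int_minus)
qed

lemma laurent_poly_real_polynomial:
  assumes "real_polynomial_function p"
  shows "laurent_poly (\<lambda>v. complex_of_real (p v))"
  using assms
proof (induction rule: real_polynomial_function.induct)
  case (linear f)
  then interpret bounded_linear f .
  define A B where "A = complex_of_real (f 1)" and "B = complex_of_real (f \<i>)"
  have "laurent_poly (\<lambda>v. (A - \<i> * B) / 2 * v powi 1 + (A + \<i> * B) / 2 * v powi (- 1))"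
    by (intro laurent_poly_add laurent_poly_cmult laurent_poly_powi)
  then show ?case
  proof (rule laurent_poly_cong)
    fix v :: complex assume v: "cmod v = 1"
    have "v = Re v *\<^sub>R 1 + Im v *\<^sub>R \<i>" by (simp add: complex_eq_iff)
    then have "f v = Re v * f 1 + Im v * f \<i>"
      by (metis add scaleR real_scaleR_def)
    moreover have "v powi (- 1) = cnj v" using powi_minus_unit[OF v, of 1] by simp
    ultimately show "complex_of_real (f v) = (A - \<i> * B) / 2 * v powi 1 + (A + \<i> * B) / 2 * v powi (- 1)"
      by (simp add: A_def B_def complex_eq_iff del: power_int_minus1_right) (simp add: field_simps)
  qed
next
  case (const c)
  show ?case by (rule laurent_poly_const)
next
  case (add f g)
  then show ?case by (simp add: laurent_poly_add)
next
  case (mult f g)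
  then show ?case by (simp add: laurent_poly_mult)
qed

lemma laurent_poly_dense_continuous:
  fixes h :: "complex \<Rightarrow> real"
  assumes "continuous_on UNIV h" "\<epsilon> > 0"
  obtains p where "laurent_poly p" "\<And>v. cmod v = 1 \<Longrightarrow> cmod (of_real (h v) - p v) < \<epsilon>"
proof -
  obtain g where g: "real_polynomial_function g" "\<And>v. v \<in> sphere 0 1 \<Longrightarrow> \<bar>h v - g v\<bar> < \<epsilon>"
    using Stone_Weierstrass_real_polynomial_function[of "sphere 0 1" h \<epsilon>] assms
    by (metis compact_sphere continuous_on_subset top_greatest)
  show ?thesis
  proof (rule that[OF laurent_poly_real_polynomial[OF g(1)]])
    fix v :: complex assume "cmod v = 1"
    then show "cmod (of_real (h v) - of_real (g v)) < \<epsilon>"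
      using g(2)[of v] by (simp flip: of_real_diff)
  qed
qed

section \<open>Square integrable functions\<close>

lemma borel_measurable_cnj [measurable]: "cnj \<in> borel_measurable borel"
  by (intro borel_measurable_continuous_onI continuous_intros)

lemma cmod_add_square_le: "(cmod (x + y))\<^sup>2 \<le> 2 * (cmod x)\<^sup>2 + 2 * (cmod y)\<^sup>2"
proof -
  have "(cmod (x + y))\<^sup>2 \<le> (cmod x + cmod y)\<^sup>2"
    by (intro power_mono norm_triangle_ineq) auto
  also have "\<dots> \<le> 2 * (cmod x)\<^sup>2 + 2 * (cmod y)\<^sup>2"
    using sum_squares_bound[of "cmod x" "cmod y"] by (simp add: power2_sum)
  finally show ?thesis .
qed

lemma integrable_square_add:
  fixes f g :: "'a \<Rightarrow> complex"
  assumes [measurable]: "f \<in> borel_measurable M" "g \<in> borel_measurable M"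
    and "integrable M (\<lambda>z. (cmod (f z))\<^sup>2)" "integrable M (\<lambda>z. (cmod (g z))\<^sup>2)"
  shows "integrable M (\<lambda>z. (cmod (f z + g z))\<^sup>2)"
proof (rule Bochner_Integration.integrable_bound)
  show "integrable M (\<lambda>z. 2 * (cmod (f z))\<^sup>2 + 2 * (cmod (g z))\<^sup>2)"
    using assms(3,4) by simp
  show "AE z in M. norm ((cmod (f z + g z))\<^sup>2) \<le> norm (2 * (cmod (f z))\<^sup>2 + 2 * (cmod (g z))\<^sup>2)"
    by (rule AE_I2) (use cmod_add_square_le in auto)
qed simp

lemma integrable_square_diff:
  fixes f g :: "'a \<Rightarrow> complex"
  assumes "f \<in> borel_measurable M" "g \<in> borel_measurable M"
    and "integrable M (\<lambda>z. (cmod (f z))\<^sup>2)" "integrable M (\<lambda>z. (cmod (g z))\<^sup>2)"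
  shows "integrable M (\<lambda>z. (cmod (f z - g z))\<^sup>2)"
  using integrable_square_add[of f M "\<lambda>z. - g z"] assms by simp

lemma integral_square_add_le:
  fixes f g :: "'a \<Rightarrow> complex"
  assumes "f \<in> borel_measurable M" "g \<in> borel_measurable M"
    and "integrable M (\<lambda>z. (cmod (f z))\<^sup>2)" "integrable M (\<lambda>z. (cmod (g z))\<^sup>2)"
  shows "(LINT z|M. (cmod (f z + g z))\<^sup>2)
    \<le> 2 * (LINT z|M. (cmod (f z))\<^sup>2) + 2 * (LINT z|M. (cmod (g z))\<^sup>2)"
proof -
  have "(LINT z|M. (cmod (f z + g z))\<^sup>2) \<le> (LINT z|M. 2 * (cmod (f z))\<^sup>2 + 2 * (cmod (g z))\<^sup>2)"
    using assms(3,4) by (intro integral_mono integrable_square_add assms cmod_add_square_le) auto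
  then show ?thesis using assms(3,4) by simp
qed

section \<open>Fourier series in a unimodular coordinate\<close>

text \<open>An abstract form of the unit circle with \<open>\<omega>\<close> in the role of \<open>cis \<theta>\<close>: the measure may live on
  any space, provided that \<open>\<omega>\<close> has the moments of the uniform measure and distinguishes
  all measurable sets.  The total mass is \<open>2 * pi\<close>.\<close>

locale unitary_coordinate = finite_measure M for M :: "'a measure" +
  fixes \<omega> :: "'a \<Rightarrow> complex"
  assumes coordinate_measurable [measurable]: "\<omega> \<in> borel_measurable M"
    and coordinate_unit: "\<And>z. z \<in> space M \<Longrightarrow> cmod (\<omega> z) = 1"
    and coordinate_generates: "\<And>A. A \<in> sets M \<Longrightarrow> \<exists>B\<in>sets borel. A = \<omega> -` B \<inter> space M"
    and coordinate_moments: "\<And>n::int. (LINT z|M. \<omega> z powi n) = (if n = 0 then 2 * pi else 0)"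
begin

lemma integrable_bounded:
  fixes f :: "'a \<Rightarrow> 'b::{banach, second_countable_topology}"
  assumes "f \<in> borel_measurable M" "\<And>z. z \<in> space M \<Longrightarrow> norm (f z) \<le> C"
  shows "integrable M f"
  using assms by (intro integrable_const_bound[of _ C]) auto

lemma cmod_coordinate_powi: "z \<in> space M \<Longrightarrow> cmod (\<omega> z powi n) = 1"
  by (simp add: norm_power_int coordinate_unit)

lemma laurent_sum_measurable [measurable]: "(\<lambda>z. laurent_sum d N (\<omega> z)) \<in> borel_measurable M"
proof -
  have [measurable]: "(\<lambda>z. \<omega> z powi n) \<in> borel_measurable M" for n
    unfolding power_int_def by measurable
  show ?thesis unfolding laurent_sum_def by measurable
qed

lemma coordinate_powi_measurable [measurable]: "(\<lambda>z. \<omega> z powi n) \<in> borel_measurable M"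
  unfolding power_int_def by measurable

lemma laurent_sum_bounded: "z \<in> space M \<Longrightarrow> cmod (laurent_sum d N (\<omega> z)) \<le> (\<Sum>n = - int N..int N. cmod (d n))"
  unfolding laurent_sum_def
  by (rule order_trans[OF norm_sum]) (simp add: norm_mult cmod_coordinate_powi)

lemma integrable_square_laurent_sum: "integrable M (\<lambda>z. (cmod (laurent_sum d N (\<omega> z)))\<^sup>2)"
proof (rule integrable_bounded)
  show "norm ((cmod (laurent_sum d N (\<omega> z)))\<^sup>2) \<le> (\<Sum>n = - int N..int N. cmod (d n))\<^sup>2"
    if "z \<in> space M" for z
    using power_mono[OF laurent_sum_bounded[OF that]] by simp
qed measurable

text \<open>Membership in the closure of the Laurent polynomials in \<open>\<omega>\<close> with respect to the distance in
  the mean.  The following lemmas enlarge this closure, from continuous functions of \<open>\<omega>\<close> over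
  indicators of closed and of Borel sets up to all square integrable functions.\<close>

definition approximable :: "('a \<Rightarrow> complex) \<Rightarrow> bool" where
  "approximable f \<longleftrightarrow> f \<in> borel_measurable M \<and> integrable M (\<lambda>z. (cmod (f z))\<^sup>2) \<and>
     (\<forall>\<epsilon>>0. \<exists>d N. (LINT z|M. (cmod (laurent_sum d N (\<omega> z) - f z))\<^sup>2) < \<epsilon>)"

lemma approximable_closed:
  assumes [measurable]: "f \<in> borel_measurable M" and "integrable M (\<lambda>z. (cmod (f z))\<^sup>2)"
    and "\<And>\<epsilon>. \<epsilon> > 0 \<Longrightarrow> \<exists>g. approximable g \<and> (LINT z|M. (cmod (g z - f z))\<^sup>2) < \<epsilon>"
  shows "approximable f"
  unfolding approximable_def
proof (intro conjI allI impI)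
  fix \<epsilon> :: real assume "\<epsilon> > 0"
  then obtain g where g: "approximable g" "(LINT z|M. (cmod (g z - f z))\<^sup>2) < \<epsilon> / 4"
    using assms(3)[of "\<epsilon> / 4"] by auto
  then have [measurable]: "g \<in> borel_measurable M" and gi: "integrable M (\<lambda>z. (cmod (g z))\<^sup>2)"
    unfolding approximable_def by auto
  obtain d N where dN: "(LINT z|M. (cmod (laurent_sum d N (\<omega> z) - g z))\<^sup>2) < \<epsilon> / 4"
    using g(1) \<open>\<epsilon> > 0\<close> unfolding approximable_def by (metis divide_pos_pos zero_less_numeral)
  have "(LINT z|M. (cmod ((laurent_sum d N (\<omega> z) - g z) + (g z - f z)))\<^sup>2)
    \<le> 2 * (LINT z|M. (cmod (laurent_sum d N (\<omega> z) - g z))\<^sup>2) + 2 * (LINT z|M. (cmod (g z - f z))\<^sup>2)"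
    by (intro integral_square_add_le integrable_square_diff integrable_square_laurent_sum gi assms(2)) auto
  with dN g(2) show "\<exists>d N. (LINT z|M. (cmod (laurent_sum d N (\<omega> z) - f z))\<^sup>2) < \<epsilon>"
    by (intro exI[of _ d] exI[of _ N]) simp
qed (use assms in auto)

lemma approximable_laurent:
  assumes "laurent_poly p"
  shows "approximable (\<lambda>z. p (\<omega> z))"
proof -
  obtain N d where p: "\<And>v. cmod v = 1 \<Longrightarrow> p v = laurent_sum d N v"
    using assms unfolding laurent_poly_def by blast
  have "approximable (\<lambda>z. laurent_sum d N (\<omega> z))"
    unfolding approximable_def
    by (intro conjI allI impI exI[of _ d] exI[of _ N] integrable_square_laurent_sum) auto
  moreover have "z \<in> space M \<Longrightarrow> laurent_sum d N (\<omega> z) = p (\<omega> z)" for z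
    using p coordinate_unit by simp
  ultimately show ?thesis
    unfolding approximable_def
    by (simp cong: measurable_cong Bochner_Integration.integrable_cong Bochner_Integration.integral_cong)
qed

text \<open>Uniform approximation on the unit circle is stronger than approximation in the mean,
  because the measure is finite.\<close>

lemma approximable_continuous:
  fixes h :: "complex \<Rightarrow> real"
  assumes h: "continuous_on UNIV h"
  shows "approximable (\<lambda>z. of_real (h (\<omega> z)))"
proof -
  have [measurable]: "h \<in> borel_measurable borel"
    using h by (rule borel_measurable_continuous_onI)
  have "bounded (h ` sphere 0 1)"
    using h by (metis compact_continuous_image compact_imp_bounded compact_sphere continuous_on_subset top_greatest)
  then obtain C where C: "\<And>v. cmod v = 1 \<Longrightarrow> \<bar>h v\<bar> \<le> C"
    unfolding bounded_iff by fastforce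
  show ?thesis
  proof (rule approximable_closed)
    show "integrable M (\<lambda>z. (cmod (complex_of_real (h (\<omega> z))))\<^sup>2)"
    proof (rule integrable_bounded)
      fix z assume "z \<in> space M"
      then show "norm ((cmod (complex_of_real (h (\<omega> z))))\<^sup>2) \<le> C\<^sup>2"
        using power_mono[OF C[OF coordinate_unit], of z 2] by simp
    qed measurable
    fix \<epsilon> :: real assume "\<epsilon> > 0"
    define D where "D = measure M (space M) + 1"
    have D: "D > 0" unfolding D_def by (simp add: add_nonneg_pos)
    define \<delta> where "\<delta> = sqrt (\<epsilon> / D)"
    have "\<delta> > 0" and \<delta>2: "\<delta>\<^sup>2 = \<epsilon> / D" using \<open>\<epsilon> > 0\<close> D by (auto simp: \<delta>_def)
    then obtain p where p: "laurent_poly p" "\<And>v. cmod v = 1 \<Longrightarrow> cmod (of_real (h v) - p v) < \<delta>"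
      using laurent_poly_dense_continuous[OF h] by blast
    have pa: "approximable (\<lambda>z. p (\<omega> z))" using p(1) by (rule approximable_laurent)
    then have [measurable]: "(\<lambda>z. p (\<omega> z)) \<in> borel_measurable M" unfolding approximable_def by auto
    have b: "(cmod (p (\<omega> z) - of_real (h (\<omega> z))))\<^sup>2 \<le> \<epsilon> / D" if "z \<in> space M" for z
      unfolding \<delta>2[symmetric] using p(2)[OF coordinate_unit[OF that]]
      by (intro power_mono) (auto simp: norm_minus_commute)
    have "(LINT z|M. (cmod (p (\<omega> z) - of_real (h (\<omega> z))))\<^sup>2) \<le> (LINT z|M. \<epsilon> / D)"
      by (rule integral_mono[OF integrable_bounded[of _ "\<epsilon> / D"]]) (use b in auto)
    also have "\<dots> = (D - 1) * (\<epsilon> / D)" by (simp add: D_def)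
    also have "\<dots> < \<epsilon>" using D \<open>\<epsilon> > 0\<close> by (simp add: field_simps)
    finally show "\<exists>g. approximable g \<and> (LINT z|M. (cmod (g z - of_real (h (\<omega> z))))\<^sup>2) < \<epsilon>"
      using pa by blast
  qed measurable
qed

lemma approximable_add:
  assumes f: "approximable f" and g: "approximable g"
  shows "approximable (\<lambda>z. f z + g z)"
proof -
  have [measurable]: "f \<in> borel_measurable M" "g \<in> borel_measurable M"
    and i: "integrable M (\<lambda>z. (cmod (f z))\<^sup>2)" "integrable M (\<lambda>z. (cmod (g z))\<^sup>2)"
    using f g unfolding approximable_def by auto
  show ?thesis
  proof (rule approximable_closed)
    fix \<epsilon> :: real assume "\<epsilon> > 0"
    then have e: "\<epsilon> / 4 > 0" by simp
    obtain d N where d: "(LINT z|M. (cmod (laurent_sum d N (\<omega> z) - f z))\<^sup>2) < \<epsilon> / 4"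
      using f e unfolding approximable_def by blast
    obtain e K where e: "(LINT z|M. (cmod (laurent_sum e K (\<omega> z) - g z))\<^sup>2) < \<epsilon> / 4"
      using g e unfolding approximable_def by blast
    have lp: "laurent_poly (\<lambda>v. laurent_sum d N v + laurent_sum e K v)"
      by (intro laurent_poly_add) (auto intro: laurent_polyI)
    have "(LINT z|M. (cmod ((laurent_sum d N (\<omega> z) - f z) + (laurent_sum e K (\<omega> z) - g z)))\<^sup>2)
      \<le> 2 * (LINT z|M. (cmod (laurent_sum d N (\<omega> z) - f z))\<^sup>2)
       + 2 * (LINT z|M. (cmod (laurent_sum e K (\<omega> z) - g z))\<^sup>2)"
      by (intro integral_square_add_le integrable_square_diff integrable_square_laurent_sum i) auto
    with d e have "(LINT z|M. (cmod ((laurent_sum d N (\<omega> z) + laurent_sum e K (\<omega> z)) - (f z + g z)))\<^sup>2) < \<epsilon>"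
      by (simp add: add_diff_add)
    with approximable_laurent[OF lp]
    show "\<exists>h. approximable h \<and> (LINT z|M. (cmod (h z - (f z + g z)))\<^sup>2) < \<epsilon>" by blast
  qed (use i in \<open>auto intro: integrable_square_add\<close>)
qed

lemma approximable_cmult:
  assumes f: "approximable f"
  shows "approximable (\<lambda>z. c * f z)"
proof (cases "c = 0")
  case True
  then show ?thesis using approximable_laurent[OF laurent_poly_const[of 0]] by simp
next
  case False
  have [measurable]: "f \<in> borel_measurable M" and i: "integrable M (\<lambda>z. (cmod (f z))\<^sup>2)"
    using f unfolding approximable_def by auto
  show ?thesis
  proof (rule approximable_closed)
    fix \<epsilon> :: real assume "\<epsilon> > 0"
    then have "\<epsilon> / (cmod c)\<^sup>2 > 0" using False by simp
    then obtain d N where d: "(LINT z|M. (cmod (laurent_sum d N (\<omega> z) - f z))\<^sup>2) < \<epsilon> / (cmod c)\<^sup>2"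
      using f unfolding approximable_def by blast
    have "(LINT z|M. (cmod (c * laurent_sum d N (\<omega> z) - c * f z))\<^sup>2)
       = (cmod c)\<^sup>2 * (LINT z|M. (cmod (laurent_sum d N (\<omega> z) - f z))\<^sup>2)"
      by (simp add: norm_mult power_mult_distrib flip: right_diff_distrib)
    also have "\<dots> < \<epsilon>" using d False by (simp add: field_simps)
    finally show "\<exists>h. approximable h \<and> (LINT z|M. (cmod (h z - c * f z))\<^sup>2) < \<epsilon>"
      using approximable_laurent[OF laurent_poly_cmult[OF laurent_polyI[of "laurent_sum d N" d N]], of c]
      by auto
  qed (use i in \<open>auto simp: norm_mult power_mult_distrib\<close>)
qed

lemma approximable_sum:
  assumes "finite I" "\<And>i. i \<in> I \<Longrightarrow> approximable (f i)"
  shows "approximable (\<lambda>z. \<Sum>i\<in>I. f i z)"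
  using assms
proof (induction I rule: finite_induct)
  case empty
  show ?case using approximable_laurent[OF laurent_poly_const[of 0]] by simp
qed (simp add: approximable_add)

text \<open>The only limit process that the enlargement requires: by dominated convergence, a dominated
  pointwise limit is also a limit in the mean.\<close>

lemma approximable_dominated_limit:
  assumes F: "\<And>n::nat. approximable (F n)"
    and lim: "\<And>z. z \<in> space M \<Longrightarrow> (\<lambda>n. F n z) \<longlonglongrightarrow> f z"
    and bound: "\<And>n z. z \<in> space M \<Longrightarrow> cmod (F n z) \<le> g z"
    and g: "integrable M (\<lambda>z. (g z)\<^sup>2)"
  shows "approximable f"
proof -
  have [measurable]: "F n \<in> borel_measurable M" for n using F unfolding approximable_def by auto
  have [measurable]: "f \<in> borel_measurable M"
    by (rule borel_measurable_LIMSEQ_metric[of F]) (use lim in auto)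
  have fb: "cmod (f z) \<le> g z" if "z \<in> space M" for z
    using tendsto_norm[OF lim[OF that]] bound[OF that] by (intro LIMSEQ_le_const2[of _ "cmod (f z)"]) auto
  have "(\<lambda>n. LINT z|M. (cmod (F n z - f z))\<^sup>2) \<longlonglongrightarrow> (LINT z|M. 0)"
  proof (rule integral_dominated_convergence)
    show "integrable M (\<lambda>z. 4 * (g z)\<^sup>2)" using g by simp
    show "AE z in M. (\<lambda>n. (cmod (F n z - f z))\<^sup>2) \<longlonglongrightarrow> 0"
    proof (rule AE_I2)
      fix z assume z: "z \<in> space M"
      have "(\<lambda>n. (cmod (F n z - f z))\<^sup>2) \<longlonglongrightarrow> (cmod (f z - f z))\<^sup>2"
        by (intro tendsto_intros lim z)
      then show "(\<lambda>n. (cmod (F n z - f z))\<^sup>2) \<longlonglongrightarrow> 0" by simp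
    qed
    show "AE z in M. norm ((cmod (F n z - f z))\<^sup>2) \<le> 4 * (g z)\<^sup>2" for n
    proof (rule AE_I2)
      fix z assume z: "z \<in> space M"
      have "cmod (F n z - f z) \<le> 2 * g z"
        using norm_triangle_ineq4[of "F n z" "f z"] bound[OF z, of n] fb[OF z] by linarith
      then show "norm ((cmod (F n z - f z))\<^sup>2) \<le> 4 * (g z)\<^sup>2"
        using power_mono[of "cmod (F n z - f z)" "2 * g z" 2] by (simp add: power_mult_distrib)
    qed
  qed measurable
  then have lim0: "(\<lambda>n. LINT z|M. (cmod (F n z - f z))\<^sup>2) \<longlonglongrightarrow> 0" by simp
  show ?thesis
  proof (rule approximable_closed)
    show "integrable M (\<lambda>z. (cmod (f z))\<^sup>2)"
      by (rule Bochner_Integration.integrable_bound[OF g])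
         (use fb in \<open>auto intro!: AE_I2 power_mono\<close>)
    fix \<epsilon> :: real assume "\<epsilon> > 0"
    then have "eventually (\<lambda>n. (LINT z|M. (cmod (F n z - f z))\<^sup>2) < \<epsilon>) sequentially"
      by (rule order_tendstoD(2)[OF lim0])
    then show "\<exists>h. approximable h \<and> (LINT z|M. (cmod (h z - f z))\<^sup>2) < \<epsilon>"
      using F unfolding eventually_sequentially by blast
  qed measurable
qed

text \<open>The indicator of a closed set is the pointwise limit of the continuous functions
  \<open>max 0 (1 - n * infdist v C)\<close>.\<close>

lemma approximable_closed_indicator:
  assumes "closed C"
  shows "approximable (\<lambda>z. indicator C (\<omega> z))"
proof (cases "C = {}")
  case True
  then show ?thesis using approximable_laurent[OF laurent_poly_const[of 0]] by simp
next
  case False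
  define h where "h n v = max 0 (1 - real n * infdist v C)" for n v
  show ?thesis
  proof (rule approximable_dominated_limit)
    show "approximable (\<lambda>z. of_real (h n (\<omega> z)))" for n
      unfolding h_def by (intro approximable_continuous continuous_intros)
    show "integrable M (\<lambda>z. 1\<^sup>2 :: real)" by simp
    show "cmod (of_real (h n (\<omega> z))) \<le> 1" for n z
      by (auto simp: h_def max_def infdist_nonneg)
    show "(\<lambda>n. of_real (h n (\<omega> z))) \<longlonglongrightarrow> (indicator C (\<omega> z) :: complex)" for z
    proof (cases "\<omega> z \<in> C")
      case True
      then show ?thesis by (simp add: h_def)
    next
      case notin: False
      then have pos: "infdist (\<omega> z) C > 0"
        using assms False infdist_pos_not_in_closed by blast
      obtain N :: nat where N: "1 / infdist (\<omega> z) C \<le> real N" using real_arch_simple by blast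
      have "h n (\<omega> z) = 0" if "n \<ge> N" for n
      proof -
        have "1 / infdist (\<omega> z) C \<le> real n" using N that by linarith
        then show ?thesis using pos by (simp add: h_def field_simps)
      qed
      then have "eventually (\<lambda>n. complex_of_real (h n (\<omega> z)) = indicator C (\<omega> z)) sequentially"
        using notin unfolding eventually_sequentially by (intro exI[of _ N]) auto
      then show ?thesis by (rule tendsto_eventually)
    qed
  qed
qed

text \<open>Dynkin's argument: closed sets are an intersection stable generator of the Borel sets, and
  approximability survives complements and disjoint countable unions.\<close>

lemma approximable_borel_indicator:
  assumes "B \<in> sets borel"
  shows "approximable (\<lambda>z. indicator B (\<omega> z))"
proof -
  have "Int_stable (Collect closed :: complex set set)"
    by (auto simp: Int_stable_def)
  moreover have "(Collect closed :: complex set set) \<subseteq> Pow UNIV" by simp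
  moreover have "B \<in> sigma_sets UNIV (Collect closed)"
    using assms by (simp add: borel_eq_closed)
  ultimately show ?thesis
  proof (induction rule: sigma_sets_induct_disjoint)
    case (basic A)
    then show ?case by (simp add: approximable_closed_indicator)
  next
    case empty
    then show ?case using approximable_laurent[OF laurent_poly_const[of 0]] by simp
  next
    case (compl A)
    have "approximable (\<lambda>z. 1 + (- 1) * indicator A (\<omega> z))"
      using approximable_laurent[OF laurent_poly_const[of 1]] compl
      by (intro approximable_add approximable_cmult) auto
    then show ?case by (simp add: indicator_diff flip: Compl_eq_Diff_UNIV add: indicator_compl)
  next
    case (union A)
    show ?case
    proof (rule approximable_dominated_limit)
      show "approximable (\<lambda>z. \<Sum>i<n. indicator (A i) (\<omega> z))" for n
        using union by (intro approximable_sum) auto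
      have eq: "(\<Sum>i<n. indicator (A i) v) = (indicator (\<Union>i<n. A i) v :: complex)" for n v
        using union(1) by (intro indicator_UN_disjoint[symmetric])
          (auto simp: disjoint_family_on_def)
      show "cmod (\<Sum>i<n. indicator (A i) (\<omega> z)) \<le> 1" for n z
        unfolding eq by (auto simp: indicator_def)
      show "integrable M (\<lambda>z. 1\<^sup>2 :: real)" by simp
      show "(\<lambda>n. \<Sum>i<n. indicator (A i) (\<omega> z)) \<longlonglongrightarrow> (indicator (\<Union>i. A i) (\<omega> z) :: complex)" for z
        unfolding eq by (rule LIMSEQ_indicator_UN)
    qed
  qed
qed

text \<open>Simple functions that converge pointwise and are dominated by \<open>2 * cmod (f z)\<close> reduce the claim
  to indicators, and each measurable set is the preimage of a Borel set under \<open>\<omega>\<close>.\<close>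

lemma approximable_square_integrable:
  assumes [measurable]: "f \<in> borel_measurable M" and "integrable M (\<lambda>z. (cmod (f z))\<^sup>2)"
  shows "approximable f"
proof -
  obtain s where s: "\<And>i. simple_function M (s i)"
      "\<And>z. z \<in> space M \<Longrightarrow> (\<lambda>i. s i z) \<longlonglongrightarrow> f z"
      "\<And>i z. z \<in> space M \<Longrightarrow> cmod (s i z) \<le> 2 * cmod (f z)"
    using borel_measurable_implies_sequence_metric[of f M 0] by (auto simp: Ball_def)
  show ?thesis
  proof (rule approximable_dominated_limit[OF _ s(2) s(3)])
    show "integrable M (\<lambda>z. (2 * cmod (f z))\<^sup>2)"
      using assms(2) by (simp add: power_mult_distrib)
    show "approximable (s i)" for i
    proof -
      have fin: "finite (s i ` space M)" using s(1) by (simp add: simple_function_def)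
      have "\<exists>B\<in>sets borel. s i -` {y} \<inter> space M = \<omega> -` B \<inter> space M" if "y \<in> s i ` space M" for y
        using that s(1) by (intro coordinate_generates) (auto simp: simple_function_def)
      then obtain B where B: "\<And>y. y \<in> s i ` space M \<Longrightarrow> B y \<in> sets borel"
          "\<And>y. y \<in> s i ` space M \<Longrightarrow> s i -` {y} \<inter> space M = \<omega> -` B y \<inter> space M"
        by metis
      have a: "approximable (\<lambda>z. \<Sum>y\<in>s i ` space M. y * indicator (B y) (\<omega> z))"
        using fin B by (intro approximable_sum approximable_cmult approximable_borel_indicator)
      have eq: "(\<Sum>y\<in>s i ` space M. y * indicator (B y) (\<omega> z)) = s i z" if z: "z \<in> space M" for z
      proof -
        have "(\<Sum>y\<in>s i ` space M. y * indicator (B y) (\<omega> z)) = (\<Sum>y\<in>s i ` space M. if y = s i z then y else 0)"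
        proof (rule sum.cong[OF refl])
          fix y assume "y \<in> s i ` space M"
          then have "\<omega> z \<in> B y \<longleftrightarrow> s i z = y" using B(2)[of y] z by blast
          then show "y * indicator (B y) (\<omega> z) = (if y = s i z then y else 0)"
            by (auto simp: indicator_def)
        qed
        also have "\<dots> = s i z" using fin z by simp
        finally show ?thesis .
      qed
      show ?thesis using a unfolding approximable_def
        by (simp add: eq cong: measurable_cong Bochner_Integration.integrable_cong Bochner_Integration.integral_cong)
    qed
  qed
qed

definition fourier_coeff :: "('a \<Rightarrow> complex) \<Rightarrow> int \<Rightarrow> complex" where
  "fourier_coeff f n = (LINT z|M. f z * \<omega> z powi (- n)) / (2 * pi)"

lemma integrable_of_square_integrable:
  fixes f :: "'a \<Rightarrow> complex"
  assumes "f \<in> borel_measurable M" and "integrable M (\<lambda>z. (cmod (f z))\<^sup>2)"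
  shows "integrable M f"
proof (rule square_integrable_imp_integrable[OF assms(1)])
  show "integrable M (\<lambda>z. (f z)\<^sup>2)"
    by (rule integrable_norm_cancel) (use assms in \<open>simp_all add: norm_power\<close>)
qed

lemma integrable_mult_coordinate:
  assumes "f \<in> borel_measurable M" "integrable M (\<lambda>z. (cmod (f z))\<^sup>2)"
  shows "integrable M (\<lambda>z. f z * \<omega> z powi n)"
  by (rule Bochner_Integration.integrable_bound[OF integrable_of_square_integrable[OF assms]])
     (use assms(1) in \<open>auto intro!: AE_I2 simp: norm_mult cmod_coordinate_powi\<close>)

text \<open>The error \<open>e\<close> of the Fourier partial sum is orthogonal to all Laurent polynomials of degree
  at most \<open>N\<close>, so any competitor differs from \<open>f\<close> by \<open>e\<close> and an orthogonal term \<open>q\<close>, and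
  Pythagoras gives the inequality.  Only this minimality is used to pass from density to
  convergence of the Fourier series.\<close>

lemma fourier_partial_sum_optimal:
  fixes f :: "'a \<Rightarrow> complex"
  assumes [measurable]: "f \<in> borel_measurable M" and i: "integrable M (\<lambda>z. (cmod (f z))\<^sup>2)"
  shows "(LINT z|M. (cmod (laurent_sum (fourier_coeff f) N (\<omega> z) - f z))\<^sup>2)
       \<le> (LINT z|M. (cmod (laurent_sum d N (\<omega> z) - f z))\<^sup>2)"
proof -
  define e where "e z = f z - laurent_sum (fourier_coeff f) N (\<omega> z)" for z
  define q where "q z = laurent_sum (\<lambda>n. d n - fourier_coeff f n) N (\<omega> z)" for z
  have [measurable]: "e \<in> borel_measurable M" "q \<in> borel_measurable M"
    unfolding e_def q_def by measurable
  have ei: "integrable M (\<lambda>z. (cmod (e z))\<^sup>2)"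
    unfolding e_def by (intro integrable_square_diff i integrable_square_laurent_sum) auto
  have qi: "integrable M (\<lambda>z. (cmod (q z))\<^sup>2)"
    unfolding q_def by (rule integrable_square_laurent_sum)
  have orth: "(LINT z|M. e z * \<omega> z powi (- n)) = 0" if n: "\<bar>n\<bar> \<le> int N" for n
  proof -
    have "(LINT z|M. laurent_sum (fourier_coeff f) N (\<omega> z) * \<omega> z powi (- n))
        = (LINT z|M. (\<Sum>k = - int N..int N. fourier_coeff f k * \<omega> z powi (k - n)))"
    proof (rule Bochner_Integration.integral_cong[OF refl])
      fix z assume "z \<in> space M"
      then have "\<omega> z \<noteq> 0" using coordinate_unit by fastforce
      then show "laurent_sum (fourier_coeff f) N (\<omega> z) * \<omega> z powi (- n)
          = (\<Sum>k = - int N..int N. fourier_coeff f k * \<omega> z powi (k - n))"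
        by (simp add: laurent_sum_def sum_distrib_right power_int_add[of "\<omega> z" _ "- n", simplified] mult.assoc)
    qed
    also have "\<dots> = (\<Sum>k = - int N..int N. fourier_coeff f k * (LINT z|M. \<omega> z powi (k - n)))"
    proof (subst Bochner_Integration.integral_sum)
      show "integrable M (\<lambda>z. fourier_coeff f k * \<omega> z powi (k - n))" for k
        by (rule integrable_bounded[of _ "cmod (fourier_coeff f k)"])
           (auto simp: norm_mult cmod_coordinate_powi)
    qed simp
    also have "\<dots> = (\<Sum>k = - int N..int N. if k = n then fourier_coeff f k * (2 * pi) else 0)"
      by (rule sum.cong) (auto simp: coordinate_moments)
    also have "\<dots> = (LINT z|M. f z * \<omega> z powi (- n))"
      using n by (auto simp: fourier_coeff_def abs_le_iff)
    finally show ?thesis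
      unfolding e_def left_diff_distrib
      by (subst Bochner_Integration.integral_diff)
         (auto intro!: integrable_mult_coordinate i integrable_square_laurent_sum)
  qed
  have qe: "(LINT z|M. e z * cnj (q z)) = 0"
  proof -
    have "(LINT z|M. e z * cnj (q z))
       = (LINT z|M. (\<Sum>n = - int N..int N. cnj (d n - fourier_coeff f n) * (e z * \<omega> z powi (- n))))"
      by (rule Bochner_Integration.integral_cong[OF refl])
         (simp add: q_def laurent_sum_def powi_minus_unit coordinate_unit sum_distrib_left mult_ac)
    also have "\<dots> = (\<Sum>n = - int N..int N. cnj (d n - fourier_coeff f n) * (LINT z|M. e z * \<omega> z powi (- n)))"
      by (subst Bochner_Integration.integral_sum) (auto intro!: integrable_mult_coordinate ei)
    also have "\<dots> = 0" by (rule sum.neutral) (auto simp: orth)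
    finally show ?thesis .
  qed
  have qei: "integrable M (\<lambda>z. e z * cnj (q z))"
  proof (rule Bochner_Integration.integrable_bound)
    show "integrable M (\<lambda>z. (cmod (e z))\<^sup>2 + (cmod (q z))\<^sup>2)" using ei qi by simp
    show "AE z in M. norm (e z * cnj (q z)) \<le> norm ((cmod (e z))\<^sup>2 + (cmod (q z))\<^sup>2)"
    proof (rule AE_I2)
      fix z
      have "2 * (cmod (e z) * cmod (q z)) \<le> (cmod (e z))\<^sup>2 + (cmod (q z))\<^sup>2"
        using sum_squares_bound[of "cmod (e z)" "cmod (q z)"] by (simp add: mult.assoc)
      moreover have "0 \<le> cmod (e z) * cmod (q z)" by simp
      ultimately have "cmod (e z) * cmod (q z) \<le> (cmod (e z))\<^sup>2 + (cmod (q z))\<^sup>2" by linarith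
      then show "norm (e z * cnj (q z)) \<le> norm ((cmod (e z))\<^sup>2 + (cmod (q z))\<^sup>2)"
        by (simp add: norm_mult)
    qed
  qed simp
  have sq: "(cmod (laurent_sum d N (\<omega> z) - f z))\<^sup>2
      = (cmod (q z))\<^sup>2 + (cmod (e z))\<^sup>2 - 2 * Re (e z * cnj (q z))" for z
  proof -
    have "laurent_sum d N (\<omega> z) - f z = q z - e z"
      by (simp add: q_def e_def laurent_sum_def left_diff_distrib sum_subtractf)
    then show ?thesis by (simp only:) (simp add: cmod_power2 power2_diff algebra_simps)
  qed
  have "(LINT z|M. (cmod (laurent_sum d N (\<omega> z) - f z))\<^sup>2)
      = (LINT z|M. (cmod (q z))\<^sup>2) + (LINT z|M. (cmod (e z))\<^sup>2) - 2 * Re (LINT z|M. e z * cnj (q z))"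
    unfolding sq using ei qi qei by (simp del: times_complex.sel)
  also have "\<dots> \<ge> (LINT z|M. (cmod (e z))\<^sup>2)" by (simp add: qe)
  finally show ?thesis by (simp add: e_def norm_minus_commute)
qed

lemma fourier_series_tendsto:
  fixes f :: "'a \<Rightarrow> complex"
  assumes [measurable]: "f \<in> borel_measurable M" and i: "integrable M (\<lambda>z. (cmod (f z))\<^sup>2)"
  shows "(\<lambda>N. LINT z|M. (cmod (laurent_sum (fourier_coeff f) N (\<omega> z) - f z))\<^sup>2) \<longlonglongrightarrow> 0"
proof (rule LIMSEQ_I)
  fix \<epsilon> :: real assume "\<epsilon> > 0"
  then obtain d K where dK: "(LINT z|M. (cmod (laurent_sum d K (\<omega> z) - f z))\<^sup>2) < \<epsilon>"
    using approximable_square_integrable[OF assms] unfolding approximable_def by blast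
  have "(LINT z|M. (cmod (laurent_sum (fourier_coeff f) N (\<omega> z) - f z))\<^sup>2) < \<epsilon>" if "N \<ge> K" for N
    using fourier_partial_sum_optimal[OF assms, of N "\<lambda>n. if \<bar>n\<bar> \<le> int K then d n else 0"] dK
    by (simp flip: laurent_sum_extend[OF that])
  then show "\<exists>K. \<forall>N\<ge>K. norm ((LINT z|M. (cmod (laurent_sum (fourier_coeff f) N (\<omega> z) - f z))\<^sup>2) - 0) < \<epsilon>"
    by auto
qed

end

section \<open>Fourier coefficients of powers of the Poisson kernel\<close>

definition angle_space :: "real measure" where
  "angle_space = restrict_space lborel {0..2 * pi}"

lemma space_angle_space: "space angle_space = {0..2 * pi}"
  by (simp add: angle_space_def)

interpretation angle: finite_measure angle_space
  unfolding angle_space_def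
  by (rule finite_measureI) (simp add: emeasure_restrict_space)

lemma angle_measurable: "f \<in> borel_measurable borel \<Longrightarrow> f \<in> borel_measurable angle_space"
  unfolding angle_space_def by (rule measurable_restrict_space1) simp

lemma cis_measurable [measurable]: "(\<lambda>t. cis (c * t)) \<in> borel_measurable borel"
  by (intro borel_measurable_continuous_onI continuous_intros)

lemma integrable_angle_bounded:
  fixes f :: "real \<Rightarrow> complex"
  assumes "f \<in> borel_measurable angle_space" "\<And>t. cmod (f t) \<le> C"
  shows "integrable angle_space f"
  using assms by (intro angle.integrable_const_bound[of _ C]) auto

lemma set_integral_angle_space:
  fixes f :: "real \<Rightarrow> complex"
  shows "(LINT t:{0..2 * pi}|lborel. f t) = (LINT t|angle_space. f t)"
  unfolding angle_space_def set_lebesgue_integral_def by (simp add: integral_restrict_space)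

lemma cis_moment:
  fixes n :: int
  shows "(LINT t|angle_space. cis (of_int n * t)) = (if n = 0 then 2 * pi else 0)"
proof (cases "n = 0")
  case True
  have "(LINT t|angle_space. cis (of_int n * t)) = (LINT t|angle_space. 1)"
    by (rule Bochner_Integration.integral_cong[OF refl]) (simp add: True)
  also have "\<dots> = of_real (measure angle_space (space angle_space))"
    by (simp add: scaleR_conv_of_real)
  also have "measure angle_space (space angle_space) = 2 * pi"
    by (simp add: space_angle_space) (simp add: angle_space_def measure_restrict_space)
  finally show ?thesis using True by simp
next
  case False
  have "(\<integral>t. indicator {0..2 * pi} t *\<^sub>R cis (of_int n * t) \<partial>lborel)
      = cis (of_int n * (2 * pi)) / (\<i> * of_int n) - cis (of_int n * 0) / (\<i> * of_int n)"
  proof (rule integral_FTC_Icc)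
    fix t :: real
    have "((\<lambda>u. exp (\<i> * (of_int n * u)) / (\<i> * of_int n)) has_field_derivative
        exp (\<i> * (of_int n * of_real t))) (at (of_real t))"
    proof -
      have "\<i> * (x * \<i>) = - x" for x :: complex by (simp add: complex_eq_iff)
      then show ?thesis using False by (auto intro!: derivative_eq_intros)
    qed
    from has_vector_derivative_real_field[OF this]
    show "((\<lambda>t. cis (of_int n * t) / (\<i> * of_int n)) has_vector_derivative cis (of_int n * t))
        (at t within {0..2 * pi})"
      by (simp add: cis_conv_exp)
  qed (auto intro!: continuous_intros)
  also have "\<dots> = 0" using cis_multiple_2pi[of "of_int n"] by (simp add: mult_ac)
  finally show ?thesis using False
    by (simp add: set_integral_angle_space[symmetric] set_lebesgue_integral_def)
qed

definition negbin :: "nat \<Rightarrow> nat \<Rightarrow> real" where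
  "negbin M q = real ((M - 1 + q) choose q)"

lemma negbin_nonneg: "0 \<le> negbin M q" by (simp add: negbin_def)

lemma negbin_sums:
  fixes u :: complex
  assumes "M \<ge> 1" "cmod u < 1"
  shows "(\<lambda>q. of_real (negbin M q) * u ^ q) sums (1 / (1 - u) ^ M)"
proof -
  have ne: "1 - u \<noteq> 0" using assms(2) by auto
  have "(\<lambda>q. ((- of_nat M) gchoose q) * (- u) ^ q) sums (1 + - u) powr (- of_nat M)"
    using assms(2) by (intro gen_binomial_complex) simp
  moreover have "((- of_nat M :: complex) gchoose q) * (- u) ^ q = of_real (negbin M q) * u ^ q" for q
  proof -
    have "(of_nat M + of_nat q - 1 :: complex) = of_nat (M - 1 + q)"
      using assms(1) by (simp add: of_nat_diff)
    then have "((- of_nat M :: complex) gchoose q) = (- 1) ^ q * (of_nat (M - 1 + q) gchoose q)"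
      by (simp only: gbinomial_minus)
    then have "((- of_nat M :: complex) gchoose q) = (- 1) ^ q * of_real (negbin M q)"
      by (simp only: negbin_def binomial_gbinomial[symmetric] of_real_of_nat_eq)
    moreover have "(- u) ^ q = (- 1) ^ q * u ^ q" by (metis power_minus)
    moreover have "(- 1 :: complex) ^ q * (- 1) ^ q = 1"
      by (simp flip: power_mult_distrib)
    ultimately show ?thesis by (simp add: mult_ac)
  qed
  moreover have "(1 + - u) powr (- of_nat M) = 1 / (1 - u) ^ M"
    using ne by (simp add: powr_minus powr_nat' divide_inverse)
  ultimately show ?thesis by simp
qed

lemma negbin_summable:
  fixes \<rho> :: real
  assumes "M \<ge> 1" "0 \<le> \<rho>" "\<rho> < 1"
  shows "summable (\<lambda>q. negbin M q * \<rho> ^ q)"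
proof -
  have "summable (\<lambda>q. of_real (negbin M q) * complex_of_real \<rho> ^ q)"
    using negbin_sums[of M "complex_of_real \<rho>"] assms by (auto simp: sums_iff)
  then have "summable (\<lambda>q. complex_of_real (negbin M q * \<rho> ^ q))" by simp
  then show ?thesis by (simp only: summable_of_real_iff)
qed

text \<open>One factor \<open>negbin M (q + k) * \<rho> ^ (q + k)\<close> is bounded, being the term of a convergent series;
  the rest is the negative binomial series itself.\<close>

lemma negbin_product_summable:
  fixes \<rho> :: real
  assumes "M \<ge> 1" "0 \<le> \<rho>" "\<rho> < 1"
  shows "summable (\<lambda>q. negbin M q * negbin M (q + k) * \<rho> ^ (2 * q + k))"
proof -
  have "(\<lambda>q. negbin M q * \<rho> ^ q) \<longlonglongrightarrow> 0"
    by (rule summable_LIMSEQ_zero[OF negbin_summable[OF assms]])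
  then have "Bseq (\<lambda>q. negbin M q * \<rho> ^ q)"
    by (metis convergentI convergent_imp_Bseq)
  then obtain K where K: "\<And>q. \<bar>negbin M q * \<rho> ^ q\<bar> \<le> K"
    unfolding Bseq_def by auto
  show ?thesis
  proof (rule summable_comparison_test')
    show "summable (\<lambda>q. K * (negbin M q * \<rho> ^ q))"
      by (intro summable_mult negbin_summable assms)
    show "norm (negbin M q * negbin M (q + k) * \<rho> ^ (2 * q + k)) \<le> K * (negbin M q * \<rho> ^ q)" for q
    proof -
      have nn: "0 \<le> negbin M q * \<rho> ^ q" using assms(2) by (simp add: negbin_nonneg)
      have "negbin M q * negbin M (q + k) * \<rho> ^ (2 * q + k)
          = (negbin M (q + k) * \<rho> ^ (q + k)) * (negbin M q * \<rho> ^ q)"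
        by (simp add: power_add mult_2 mult_ac del: power_mult)
           (simp add: power_mult power2_eq_square mult_ac power_mult_distrib)
      then have "norm (negbin M q * negbin M (q + k) * \<rho> ^ (2 * q + k))
          = \<bar>negbin M (q + k) * \<rho> ^ (q + k)\<bar> * (negbin M q * \<rho> ^ q)"
        using nn by (simp only: real_norm_def abs_mult[of _ "negbin M q * \<rho> ^ q"] abs_of_nonneg)
      also have "\<dots> \<le> K * (negbin M q * \<rho> ^ q)" by (rule mult_right_mono[OF K nn])
      finally show ?thesis .
    qed
  qed
qed

text \<open>Absolutely summable coefficients bound all partial sums by one constant, so the series may be integrated term by term against a bounded function.\<close>

lemma integral_cis_series:
  fixes h :: "real \<Rightarrow> complex" and s :: "nat \<Rightarrow> int"
  assumes [measurable]: "h \<in> borel_measurable angle_space" and h: "\<And>t. cmod (h t) \<le> C"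
    and c: "summable (\<lambda>p. cmod (c p))"
  shows "(\<lambda>p. c p * (LINT t|angle_space. h t * cis (of_int (s p) * t))) sums
         (LINT t|angle_space. h t * (\<Sum>p. c p * cis (of_int (s p) * t)))"
proof -
  have [measurable]: "(\<lambda>t. cis (c * t)) \<in> borel_measurable angle_space" for c
    by (intro angle_measurable) measurable
  have C: "0 \<le> C" using h[of 0] norm_ge_zero order_trans by blast
  let ?f = "\<lambda>p t. c p * (h t * cis (of_int (s p) * t))"
  have b: "cmod (?f p t) \<le> cmod (c p) * C" for p t
    using h[of t] by (simp add: norm_mult mult_left_mono)
  have i: "integrable angle_space (?f p)" for p
    by (rule integrable_angle_bounded[OF _ b]) measurable
  have sumC: "summable (\<lambda>p. cmod (c p) * C)" by (rule summable_mult2[OF c])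
  have sm: "summable (\<lambda>p. cmod (?f p t))" for t
    by (rule summable_comparison_test'[OF sumC]) (use b in auto)
  have "(\<lambda>p. LINT t|angle_space. ?f p t) sums (LINT t|angle_space. (\<Sum>p. ?f p t))"
  proof (rule sums_integral[OF i])
    show "AE t in angle_space. summable (\<lambda>p. cmod (?f p t))" using sm by simp
    show "summable (\<lambda>p. LINT t|angle_space. cmod (?f p t))"
    proof (rule summable_comparison_test')
      show "summable (\<lambda>p. (cmod (c p) * C) * measure angle_space (space angle_space))"
        by (rule summable_mult2[OF sumC])
      fix p
      have "(LINT t|angle_space. cmod (?f p t)) \<le> (LINT t|angle_space. cmod (c p) * C)"
        using b i by (intro integral_mono) auto
      then show "norm (LINT t|angle_space. cmod (?f p t))
          \<le> (cmod (c p) * C) * measure angle_space (space angle_space)"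
        by (simp add: integral_nonneg_AE mult_ac)
    qed
  qed
  moreover have "(\<Sum>p. ?f p t) = h t * (\<Sum>p. c p * cis (of_int (s p) * t))" for t
  proof -
    have "summable (\<lambda>p. c p * cis (of_int (s p) * t))"
      by (rule summable_norm_cancel) (simp add: norm_mult c)
    from suminf_mult[OF this, of "h t"] show ?thesis by (simp add: mult_ac)
  qed
  ultimately show ?thesis by simp
qed

lemma integral_power_series_coeff:
  fixes c :: "nat \<Rightarrow> complex"
  assumes c: "summable (\<lambda>q. cmod (c q))"
  shows "(LINT t|angle_space. cis (- of_int j * t) * (\<Sum>q. c q * cis (of_int (int q) * t)))
    = (if j \<ge> 0 then 2 * pi * c (nat j) else 0)"
proof -
  have m: "(\<lambda>t. cis (- of_int j * t)) \<in> borel_measurable angle_space"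
    by (intro angle_measurable) measurable
  have "(\<lambda>q. c q * (LINT t|angle_space. cis (- of_int j * t) * cis (of_int (int q) * t))) sums
      (LINT t|angle_space. cis (- of_int j * t) * (\<Sum>q. c q * cis (of_int (int q) * t)))"
    by (rule integral_cis_series[OF m _ c, of 1]) simp
  moreover have "c q * (LINT t|angle_space. cis (- of_int j * t) * cis (of_int (int q) * t))
      = (if q = nat j then (if j \<ge> 0 then 2 * pi * c q else 0) else 0)" for q
  proof -
    have "(LINT t|angle_space. cis (- of_int j * t) * cis (of_int (int q) * t))
       = (LINT t|angle_space. cis (of_int (int q - j) * t))"
      by (rule Bochner_Integration.integral_cong[OF refl]) (simp add: cis_mult algebra_simps)
    also have "\<dots> = (if int q - j = 0 then 2 * pi else 0)" by (simp only: cis_moment)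
    finally show ?thesis by auto
  qed
  ultimately have "(\<lambda>q. if q = nat j then (if j \<ge> 0 then 2 * pi * c q else 0) else 0) sums
      (LINT t|angle_space. cis (- of_int j * t) * (\<Sum>q. c q * cis (of_int (int q) * t)))"
    by simp
  from sums_unique2[OF this sums_single] show ?thesis by simp
qed

lemma radius_pos_less_1:
  assumes "a > 1"
  shows "0 < radius a" "radius a < 1"
proof -
  have c: "focus a < a" unfolding focus_def
    using assms by (intro real_less_lsqrt) auto
  show "0 < radius a" using c by (simp add: radius_def)
  have "a - 1 < focus a"
    unfolding focus_def using assms by (intro real_less_rsqrt) (auto simp: power2_eq_square algebra_simps)
  then show "radius a < 1" by (simp add: radius_def)
qed

lemma poisson_coeff_pos:
  assumes "a > 1" "M \<ge> 1"
  shows "poisson_coeff a M n > 0"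
proof -
  note r = radius_pos_less_1[OF assms(1)]
  have "0 < (\<Sum>q. negbin M q * negbin M (q + nat \<bar>n\<bar>) * radius a ^ (2 * q + nat \<bar>n\<bar>))"
  proof (rule suminf_pos2[where i = 0])
    show "0 < negbin M 0 * negbin M (0 + nat \<bar>n\<bar>) * radius a ^ (2 * 0 + nat \<bar>n\<bar>)"
      using r by (simp add: negbin_def zero_less_binomial)
  qed (use r assms in \<open>auto intro: negbin_product_summable simp: negbin_nonneg\<close>)
  then show ?thesis by (simp add: poisson_coeff_def negbin_def add.assoc)
qed

text \<open>For \<open>cmod \<kappa> = 1\<close> one has \<open>(cmod (\<kappa> - w))\<^sup>2 = (1 - cnj \<kappa> * w) * (1 - \<kappa> * cnj w)\<close>.  Both factors to
  the power \<open>- M\<close> are negative binomial series, one in \<open>cnj \<kappa>\<close>, the other in \<open>\<kappa>\<close>; integration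
  against \<open>\<kappa> powi (- n)\<close> keeps the products of terms of orders \<open>p\<close> and \<open>p + n\<close>.\<close>

lemma poisson_integral:
  fixes n :: int and v :: complex
  assumes "a > 1" "M \<ge> 1" "cmod v = 1"
  shows "(LINT t|angle_space. cis (- of_int n * t) / of_real (cmod (cis t - of_real (radius a) * v) ^ (2 * M)))
     = 2 * pi * poisson_coeff a M n * v powi (- n)"
proof -
  define r where "r = radius a"
  have r: "0 < r" "r < 1" using radius_pos_less_1[OF assms(1)] by (simp_all add: r_def)
  define w where "w = of_real r * v"
  have cw: "cmod w = r" using r assms(3) by (simp add: w_def norm_mult)
  define b where "b q = negbin M q" for q
  define B where "B t = 1 / (1 - cis t * cnj w) ^ M" for t :: real
  have [measurable]: "cis \<in> borel_measurable borel"
    using cis_measurable[of 1] by simp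
  have Bm: "B \<in> borel_measurable angle_space"
    unfolding B_def by (intro angle_measurable) measurable
  have u1: "cmod (cis t * cnj w) < 1" "cmod (cis (- t) * w) < 1" for t
    using r by (simp_all add: norm_mult cw)
  have ne: "1 - cis t * cnj w \<noteq> 0" for t
    using u1(1)[of t] by auto
  have Bb: "cmod (B t) \<le> 1 / (1 - r) ^ M" for t
  proof -
    have "1 - r \<le> cmod (1 - cis t * cnj w)"
      using norm_triangle_ineq2[of 1 "cis t * cnj w"] by (simp add: norm_mult cw)
    then have "(1 - r) ^ M \<le> cmod (1 - cis t * cnj w) ^ M" using r by (intro power_mono) auto
    then show ?thesis unfolding B_def using r by (simp add: norm_divide norm_power frac_le)
  qed
  have Bs: "B t = (\<Sum>q. (of_real (b q) * cnj w ^ q) * cis (of_int (int q) * t))" for t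
    using sums_unique[OF negbin_sums[OF assms(2) u1(1)[of t]]]
    by (simp add: B_def b_def power_mult_distrib Complex.DeMoivre mult_ac)
  have sumb: "summable (\<lambda>q. cmod (of_real (b q) * w ^ q))" "summable (\<lambda>q. cmod (of_real (b q) * cnj w ^ q))"
    using negbin_summable[OF assms(2), of r] r
    by (simp_all add: b_def norm_mult norm_power cw negbin_nonneg)
  have kern: "1 / of_real (cmod (cis t - w) ^ (2 * M))
      = B t * (\<Sum>p. (of_real (b p) * w ^ p) * cis (of_int (- int p) * t))" for t
  proof -
    have "(cis t - w) = cis t * (1 - cis (- t) * w)" "cnj (cis t - w) = cis (- t) * (1 - cis t * cnj w)"
      by (simp_all add: right_diff_distrib cis_mult cis_cnj flip: mult.assoc)
    then have "(cis t - w) * cnj (cis t - w) = (cis t * cis (- t)) * ((1 - cis (- t) * w) * (1 - cis t * cnj w))"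
      by (metis (no_types, lifting) mult.assoc mult.commute)
    then have "of_real ((cmod (cis t - w))\<^sup>2) = (1 - cis (- t) * w) * (1 - cis t * cnj w)"
      by (simp only: complex_norm_square) (simp add: cis_mult)
    then have "of_real (cmod (cis t - w) ^ (2 * M)) = ((1 - cis (- t) * w) * (1 - cis t * cnj w)) ^ M"
      by (simp add: power_mult)
    then have "1 / of_real (cmod (cis t - w) ^ (2 * M)) = B t * (1 / (1 - cis (- t) * w) ^ M)"
      by (simp add: B_def power_mult_distrib)
    also have "1 / (1 - cis (- t) * w) ^ M = (\<Sum>p. of_real (b p) * (cis (- t) * w) ^ p)"
      using sums_unique[OF negbin_sums[OF assms(2) u1(2)[of t]]] by (simp add: b_def)
    also have "\<dots> = (\<Sum>p. (of_real (b p) * w ^ p) * cis (of_int (- int p) * t))"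
      by (simp only: power_mult_distrib Complex.DeMoivre) (simp add: mult_ac)
    finally show ?thesis .
  qed
  let ?I = "LINT t|angle_space. cis (- of_int n * t) / of_real (cmod (cis t - w) ^ (2 * M))"
  let ?h = "\<lambda>t. cis (- of_int n * t) * B t"
  have [measurable]: "(\<lambda>t. cis (c * t)) \<in> borel_measurable angle_space" for c
    by (intro angle_measurable) measurable
  note Bm [measurable]
  have hm: "?h \<in> borel_measurable angle_space" by measurable
  have "(\<lambda>p. (of_real (b p) * w ^ p) * (LINT t|angle_space. ?h t * cis (of_int (- int p) * t))) sums
      (LINT t|angle_space. ?h t * (\<Sum>p. (of_real (b p) * w ^ p) * cis (of_int (- int p) * t)))"
    by (rule integral_cis_series[OF hm, of "1 / (1 - r) ^ M"]) (use sumb Bb in \<open>auto simp: norm_mult\<close>)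
  moreover have "(LINT t|angle_space. ?h t * (\<Sum>p. (of_real (b p) * w ^ p) * cis (of_int (- int p) * t))) = ?I"
  proof (rule Bochner_Integration.integral_cong[OF refl])
    fix t
    have "cis (- of_int n * t) / of_real (cmod (cis t - w) ^ (2 * M)) =
        cis (- of_int n * t) * (1 / of_real (cmod (cis t - w) ^ (2 * M)))" by simp
    then show "?h t * (\<Sum>p. (of_real (b p) * w ^ p) * cis (of_int (- int p) * t))
        = cis (- of_int n * t) / of_real (cmod (cis t - w) ^ (2 * M))"
      by (simp only: kern mult.assoc)
  qed
  moreover have "(LINT t|angle_space. ?h t * cis (of_int (- int p) * t))
      = (if n + int p \<ge> 0 then 2 * pi * (of_real (b (nat (n + int p))) * cnj w ^ nat (n + int p)) else 0)" for p
  proof -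
    have "(LINT t|angle_space. ?h t * cis (of_int (- int p) * t))
       = (LINT t|angle_space. cis (- of_int (n + int p) * t) *
            (\<Sum>q. (of_real (b q) * cnj w ^ q) * cis (of_int (int q) * t)))"
    proof (rule Bochner_Integration.integral_cong[OF refl])
      fix t
      have "cis (- of_int n * t) * cis (of_int (- int p) * t) = cis (- of_int (n + int p) * t)"
        by (simp add: cis_mult algebra_simps)
      then show "?h t * cis (of_int (- int p) * t) = cis (- of_int (n + int p) * t) *
            (\<Sum>q. (of_real (b q) * cnj w ^ q) * cis (of_int (int q) * t))"
        by (simp only: Bs[symmetric]) (metis mult.assoc mult.commute)
    qed
    also have "\<dots> = (if n + int p \<ge> 0 then 2 * pi * (of_real (b (nat (n + int p))) * cnj w ^ nat (n + int p)) else 0)"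
      by (rule integral_power_series_coeff[OF sumb(2)])
    finally show ?thesis .
  qed
  ultimately have S: "(\<lambda>p. (of_real (b p) * w ^ p) *
      (if n + int p \<ge> 0 then 2 * pi * (of_real (b (nat (n + int p))) * cnj w ^ nat (n + int p)) else 0)) sums ?I"
    (is "?S sums _") by simp
  define k where "k = nat \<bar>n\<bar>"
  have pc: "(\<lambda>q. b q * b (q + k) * r ^ (2 * q + k)) sums poisson_coeff a M n"
    using summable_sums[OF negbin_product_summable[OF assms(2), of r k]] r
    by (simp add: poisson_coeff_def k_def r_def b_def negbin_def add.assoc)
  have vv: "v * cnj v = 1" using assms(3) by (simp add: complex_norm_square[symmetric])
  have "?S sums (complex_of_real (2 * pi) * v powi (- n) * of_real (poisson_coeff a M n))"
  proof (cases "n \<ge> 0")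
    case True
    \<comment> \<open>all \<open>p \<ge> 0\<close> have a partner \<open>p + n \<ge> 0\<close>\<close>
    then have n: "n = int k" by (simp add: k_def)
    have "?S p = complex_of_real (2 * pi) * v powi (- n) * of_real (b p * b (p + k) * r ^ (2 * p + k))" for p
    proof -
      have "w ^ p * cnj w ^ (p + k) = of_real (r ^ (2 * p + k)) * ((v * cnj v) ^ p * cnj v ^ k)"
        by (simp add: w_def power_mult_distrib power_add mult_2_right mult_ac)
      also have "\<dots> = of_real (r ^ (2 * p + k)) * v powi (- n)"
        using powi_minus_unit[OF assms(3), of n] by (simp add: vv n)
      finally have *: "w ^ p * cnj w ^ (p + k) = of_real (r ^ (2 * p + k)) * v powi (- n)" .
      have "nat (n + int p) = p + k" using n by simp
      then have "?S p = 2 * pi * (of_real (b p) * of_real (b (p + k)) * (w ^ p * cnj w ^ (p + k)))"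
        using n by (simp add: mult_ac)
      also have "\<dots> = complex_of_real (2 * pi) * v powi (- n) * of_real (b p * b (p + k) * r ^ (2 * p + k))"
        unfolding * by (simp add: mult_ac)
      finally show ?thesis .
    qed
    moreover have "(\<lambda>p. complex_of_real (2 * pi) * v powi (- n) * of_real (b p * b (p + k) * r ^ (2 * p + k))) sums
        (complex_of_real (2 * pi) * v powi (- n) * of_real (poisson_coeff a M n))"
      by (intro sums_mult sums_of_real pc)
    ultimately show ?thesis by (simp only:)
  next
    case False
    then have n: "n = - int k" by (simp add: k_def)
    \<comment> \<open>now \<open>p = q + k\<close> with \<open>q \<ge> 0\<close>; the first \<open>k\<close> terms vanish\<close>
    have "?S (q + k) = complex_of_real (2 * pi) * v powi (- n) * of_real (b q * b (q + k) * r ^ (2 * q + k))" for q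
    proof -
      have "w ^ (q + k) * cnj w ^ q = of_real (r ^ (2 * q + k)) * ((v * cnj v) ^ q * v ^ k)"
        by (simp add: w_def power_mult_distrib power_add mult_2_right mult_ac)
      also have "\<dots> = of_real (r ^ (2 * q + k)) * v powi (- n)"
        by (simp add: vv n)
      finally have *: "w ^ (q + k) * cnj w ^ q = of_real (r ^ (2 * q + k)) * v powi (- n)" .
      have "nat (n + int (q + k)) = q" using n by simp
      then have "?S (q + k) = 2 * pi * (of_real (b q) * of_real (b (q + k)) * (w ^ (q + k) * cnj w ^ q))"
        using n by (simp add: mult_ac)
      also have "\<dots> = complex_of_real (2 * pi) * v powi (- n) * of_real (b q * b (q + k) * r ^ (2 * q + k))"
        unfolding * by (simp add: mult_ac)
      finally show ?thesis .
    qed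
    moreover have "(\<lambda>p. complex_of_real (2 * pi) * v powi (- n) * of_real (b p * b (p + k) * r ^ (2 * p + k))) sums
        (complex_of_real (2 * pi) * v powi (- n) * of_real (poisson_coeff a M n))"
      by (intro sums_mult sums_of_real pc)
    ultimately have "(\<lambda>q. ?S (q + k)) sums (complex_of_real (2 * pi) * v powi (- n) * of_real (poisson_coeff a M n))"
      by (simp only:)
    then have "?S sums (complex_of_real (2 * pi) * v powi (- n) * of_real (poisson_coeff a M n) + (\<Sum>i<k. ?S i))"
      by (rule iffD1[OF sums_iff_shift])
    moreover have "(\<Sum>i<k. ?S i) = 0" using n by (intro sum.neutral) auto
    ultimately show ?thesis by (simp only: add_0_right)
  qed
  from sums_unique2[OF S this] show ?thesis by (simp add: w_def r_def mult_ac)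
qed

section \<open>The Moebius coordinate of the circle\<close>

text \<open>The Moebius coordinate, divided by the radius of its image circle, so that it has modulus \<open>1\<close>.\<close>

definition disk_coord :: "real \<Rightarrow> complex \<Rightarrow> complex" where
  "disk_coord a z = (z - of_real (focus a)) / (of_real (radius a) * (z + of_real (focus a)))"

text \<open>The push-forward of this measure under \<open>disk_coord a\<close> is arc length of the unit circle.\<close>

definition angle_measure :: "real \<Rightarrow> complex measure" where
  "angle_measure a = density (arc_length a) (\<lambda>z. ennreal (focus a / Re z))"

lemma focus_radius:
  assumes "a > 1"
  shows "0 < focus a" "(focus a)\<^sup>2 = a\<^sup>2 - 1" "focus a < a"
    "radius a * (a + focus a) = 1" "(radius a)\<^sup>2 = 2 * a * radius a - 1"
    "1 - (radius a)\<^sup>2 = 2 * radius a * focus a"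
proof -
  have "a\<^sup>2 > 1" using assms by (simp add: one_less_power)
  then show c: "0 < focus a" and c2: "(focus a)\<^sup>2 = a\<^sup>2 - 1"
    by (simp_all add: focus_def)
  show "focus a < a"
    using radius_pos_less_1[OF assms] by (simp add: radius_def)
  show "radius a * (a + focus a) = 1" "(radius a)\<^sup>2 = 2 * a * radius a - 1"
    "1 - (radius a)\<^sup>2 = 2 * radius a * focus a"
    using c2 by (simp_all add: radius_def power2_eq_square algebra_simps)
qed

lemma circle_cmod_square:
  assumes "a > 1" "z \<in> sphere (complex_of_real a) 1"
  shows "(Re z)\<^sup>2 + (Im z)\<^sup>2 = 2 * a * Re z - (focus a)\<^sup>2"
proof -
  have "(cmod (z - of_real a))\<^sup>2 = 1"
    using assms(2) by (simp add: dist_norm norm_minus_commute)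
  then show ?thesis
    using focus_radius(2)[OF assms(1)] by (simp add: cmod_power2 power2_diff algebra_simps)
qed

lemma circle_Re_bounds:
  assumes "z \<in> sphere (complex_of_real a) 1"
  shows "a - 1 \<le> Re z" "Re z \<le> a + 1"
  using assms abs_Re_le_cmod[of "z - of_real a"]
  by (auto simp: dist_norm norm_minus_commute abs_le_iff)

lemma circle_Re_pos:
  assumes "a > 1" "z \<in> sphere (complex_of_real a) 1"
  shows "0 < Re z"
  using circle_Re_bounds[OF assms(2)] assms(1) by linarith

lemma circle_add_focus_nonzero:
  assumes "a > 1" "z \<in> sphere (complex_of_real a) 1"
  shows "z + of_real (focus a) \<noteq> 0"
  using circle_Re_pos[OF assms] focus_radius(1)[OF assms(1)]
  by (auto simp: complex_eq_iff)

text \<open>The circle is a circle of Apollonius with respect to the points \<open>focus a\<close> and \<open>- focus a\<close>.\<close>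

lemma circle_focal_distances:
  assumes "a > 1" "z \<in> sphere (complex_of_real a) 1"
  shows "(cmod (z - of_real (focus a)))\<^sup>2 = 2 * radius a * Re z"
    "radius a * (cmod (z + of_real (focus a)))\<^sup>2 = 2 * Re z"
proof -
  show "(cmod (z - of_real (focus a)))\<^sup>2 = 2 * radius a * Re z"
    using circle_cmod_square[OF assms]
    by (simp add: cmod_power2 power2_diff radius_def algebra_simps)
  have "(cmod (z + of_real (focus a)))\<^sup>2 = 2 * (a + focus a) * Re z"
    using circle_cmod_square[OF assms]
    by (simp add: cmod_power2 power2_sum algebra_simps)
  then have "radius a * (cmod (z + of_real (focus a)))\<^sup>2 = (radius a * (a + focus a)) * (2 * Re z)"
    by (simp add: mult_ac)
  then show "radius a * (cmod (z + of_real (focus a)))\<^sup>2 = 2 * Re z"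
    by (simp add: focus_radius(4)[OF assms(1)])
qed

lemma cmod_disk_coord:
  assumes "a > 1" "z \<in> sphere (complex_of_real a) 1"
  shows "cmod (disk_coord a z) = 1"
proof -
  note r = radius_pos_less_1[OF assms(1)]
  have ne: "cmod (z + of_real (focus a)) \<noteq> 0" using circle_add_focus_nonzero[OF assms] by simp
  have "(cmod (z - of_real (focus a)))\<^sup>2 = (radius a * cmod (z + of_real (focus a)))\<^sup>2"
  proof -
    have "(radius a * cmod (z + of_real (focus a)))\<^sup>2 = radius a * (radius a * (cmod (z + of_real (focus a)))\<^sup>2)"
      by (simp add: power2_eq_square mult_ac)
    then show ?thesis by (simp only: circle_focal_distances[OF assms])
  qed
  then have "cmod (z - of_real (focus a)) = radius a * cmod (z + of_real (focus a))"
    using r by (intro power2_eq_imp_eq[of "cmod (z - of_real (focus a))"]) auto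
  then show ?thesis
    using r ne by (simp add: disk_coord_def norm_divide norm_mult)
qed

lemma disk_coord_inverse:
  assumes "a > 1" "z \<in> sphere (complex_of_real a) 1"
  shows "of_real (focus a) * (1 + of_real (radius a) * disk_coord a z)
           / (1 - of_real (radius a) * disk_coord a z) = z"
proof -
  note r = radius_pos_less_1[OF assms(1)]
  let ?c = "complex_of_real (focus a)"
  have ne: "z + ?c \<noteq> 0" by (rule circle_add_focus_nonzero[OF assms])
  have c: "?c \<noteq> 0" using focus_radius(1)[OF assms(1)] by simp
  have w: "of_real (radius a) * disk_coord a z = (z - ?c) / (z + ?c)"
    using r by (simp add: disk_coord_def)
  have "1 + (z - ?c) / (z + ?c) = 2 * z / (z + ?c)" "1 - (z - ?c) / (z + ?c) = 2 * ?c / (z + ?c)"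
    using ne by (simp_all add: field_simps)
  then show ?thesis unfolding w using ne c by simp
qed

text \<open>The inverse of the Moebius map \<open>k \<mapsto> (k - c) / (k + c)\<close>; it maps the unit circle without \<open>1\<close>
  onto the imaginary axis.\<close>

definition cayley_point :: "real \<Rightarrow> complex \<Rightarrow> complex" where
  "cayley_point a \<kappa> = of_real (focus a) * (1 + \<kappa>) / (1 - \<kappa>)"

text \<open>Both factors of \<open>kern\<close> are linear in \<open>k\<close>, and clearing the denominators of the Moebius maps
  gives \<open>k - z = (\<kappa> - w) * (z + c) / (1 - \<kappa>)\<close> and
  \<open>k + cnj z = (1 - \<kappa> * cnj w) * (cnj z + c) / (1 - \<kappa>)\<close>.  For \<open>cmod \<kappa> = 1\<close> the second numerator is
  \<open>\<kappa>\<close> times the conjugate of the first.\<close>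

lemma kern_cayley_point:
  assumes "a > 1" "z \<in> sphere (complex_of_real a) 1" "cmod \<kappa> = 1" "\<kappa> \<noteq> 1"
  shows "kern (cayley_point a \<kappa>) z =
    2 * \<kappa> * of_real (Re z) * of_real ((cmod (\<kappa> - of_real (radius a) * disk_coord a z))\<^sup>2)
      / (of_real (radius a) * (1 - \<kappa>)\<^sup>2)"
proof -
  note r = radius_pos_less_1[OF assms(1)]
  let ?c = "complex_of_real (focus a)"
  have ne: "z + ?c \<noteq> 0" "1 - \<kappa> \<noteq> 0" using circle_add_focus_nonzero[OF assms(1,2)] assms(4) by auto
  have ne': "cnj z + ?c \<noteq> 0" using ne(1) by (metis complex_cnj_add complex_cnj_complex_of_real complex_cnj_zero_iff)
  define w where "w = (z - ?c) / (z + ?c)"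
  have w: "of_real (radius a) * disk_coord a z = w"
    using r by (simp add: disk_coord_def w_def)
  have wc: "cnj w = (cnj z - ?c) / (cnj z + ?c)" by (simp add: w_def)
  have k1: "\<kappa> * cnj \<kappa> = 1" using assms(3) by (simp add: complex_norm_square[symmetric])
  have "w * (z + ?c) = z - ?c" using ne by (simp add: w_def)
  then have "?c * (1 + \<kappa>) - z * (1 - \<kappa>) = (\<kappa> - w) * (z + ?c)"
    by (simp add: left_diff_distrib) (simp add: algebra_simps)
  moreover have "cayley_point a \<kappa> - z = (?c * (1 + \<kappa>) - z * (1 - \<kappa>)) / (1 - \<kappa>)"
    using ne by (simp add: cayley_point_def diff_divide_distrib)
  ultimately have 1: "cayley_point a \<kappa> - z = (\<kappa> - w) * (z + ?c) / (1 - \<kappa>)" by simp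
  have "cnj w * (cnj z + ?c) = cnj z - ?c" using ne' by (simp add: wc)
  then have "?c * (1 + \<kappa>) + cnj z * (1 - \<kappa>) = (1 - \<kappa> * cnj w) * (cnj z + ?c)"
    by (simp add: left_diff_distrib mult.assoc) (simp add: algebra_simps)
  moreover have "cayley_point a \<kappa> + cnj z = (?c * (1 + \<kappa>) + cnj z * (1 - \<kappa>)) / (1 - \<kappa>)"
    using ne by (simp add: cayley_point_def add_divide_distrib)
  ultimately have "cayley_point a \<kappa> + cnj z = (1 - \<kappa> * cnj w) * (cnj z + ?c) / (1 - \<kappa>)"
    by simp
  also have "1 - \<kappa> * cnj w = \<kappa> * cnj (\<kappa> - w)" using k1 by (simp add: right_diff_distrib)
  finally have 2: "cayley_point a \<kappa> + cnj z = \<kappa> * cnj (\<kappa> - w) * cnj (z + ?c) / (1 - \<kappa>)" by simp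
  have "kern (cayley_point a \<kappa>) z = \<kappa> * ((\<kappa> - w) * cnj (\<kappa> - w)) * ((z + ?c) * cnj (z + ?c)) / (1 - \<kappa>)\<^sup>2"
    unfolding kern_def 1 2 using ne by (simp add: power2_eq_square)
  also have "\<dots> = \<kappa> * of_real ((cmod (\<kappa> - w))\<^sup>2) * of_real ((cmod (z + ?c))\<^sup>2) / (1 - \<kappa>)\<^sup>2"
    by (simp only: complex_norm_square)
  also have "(cmod (z + ?c))\<^sup>2 = 2 * Re z / radius a"
    using circle_focal_distances(2)[OF assms(1,2)] r by (simp add: field_simps)
  finally show ?thesis unfolding w by (simp add: mult_ac)
qed

text \<open>The imaginary axis keeps the distance \<open>a > 1\<close> from both centres.\<close>

lemma cayley_point_exterior:
  assumes "a > 1" "cmod \<kappa> = 1"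
  shows "cayley_point a \<kappa> \<in> exterior_domain a"
proof -
  have "(1 + \<kappa>) / (1 - \<kappa>) = (1 + \<kappa>) * cnj (1 - \<kappa>) / of_real ((cmod (1 - \<kappa>))\<^sup>2)"
    by (metis complex_div_cnj)
  also have "(1 + \<kappa>) * cnj (1 - \<kappa>) = \<kappa> - cnj \<kappa>"
    using assms(2) by (simp add: algebra_simps complex_norm_square[symmetric])
  finally have "Re ((1 + \<kappa>) / (1 - \<kappa>)) = 0"
    by (simp add: Re_divide_of_real del: of_real_power)
  then have Re0: "Re (cayley_point a \<kappa>) = 0"
    unfolding cayley_point_def by (simp add: times_divide_eq_right[symmetric] del: times_divide_eq_right)
  have "1 < cmod (complex_of_real a - cayley_point a \<kappa>)" "1 < cmod (complex_of_real (- a) - cayley_point a \<kappa>)"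
    using abs_Re_le_cmod[of "complex_of_real a - cayley_point a \<kappa>"]
      abs_Re_le_cmod[of "complex_of_real (- a) - cayley_point a \<kappa>"] Re0 assms(1) by auto
  then show ?thesis by (auto simp: exterior_domain_def dist_norm)
qed

section \<open>Arc length and the angular measure\<close>

lemma space_arc_length: "space (arc_length a) = sphere (complex_of_real a) 1"
  by (simp add: arc_length_def space_restrict_space)

lemma sets_arc_length: "sets (arc_length a) = sets (restrict_space borel (sphere (complex_of_real a) 1))"
  by (simp add: arc_length_def)

lemma arc_parametrization_measurable:
  "(\<lambda>\<theta>. complex_of_real a + cis \<theta>) \<in>
     restrict_space lborel {0..<2 * pi} \<rightarrow>\<^sub>M restrict_space borel (sphere (complex_of_real a) 1)"
proof (rule measurable_restrict_space2)
  show "(\<lambda>\<theta>. complex_of_real a + cis \<theta>) \<in> borel_measurable (restrict_space lborel {0..<2 * pi})"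
    by (intro measurable_restrict_space1) (simp, intro borel_measurable_continuous_onI continuous_intros)
qed (auto simp: dist_norm)

lemma finite_measure_arc_length: "finite_measure (arc_length a)"
proof -
  interpret L: finite_measure "restrict_space lborel {0..<2 * pi}"
    by (rule finite_measureI) (simp add: emeasure_restrict_space)
  show ?thesis unfolding arc_length_def by (rule L.finite_measure_distr[OF arc_parametrization_measurable])
qed

lemma continuous_on_arc_measurable:
  fixes f :: "complex \<Rightarrow> 'b::topological_space"
  assumes "continuous_on (sphere (complex_of_real a) 1) f"
  shows "f \<in> borel_measurable (arc_length a)"
proof -
  have "f \<in> borel_measurable (restrict_space borel (sphere (complex_of_real a) 1))"
    by (rule borel_measurable_continuous_on_restrict[OF assms])
  then show ?thesis by (subst measurable_cong_sets[OF sets_arc_length refl])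
qed

lemma continuous_on_circle_bounded:
  fixes h :: "complex \<Rightarrow> 'b::real_normed_vector"
  assumes "continuous_on (sphere (complex_of_real a) 1) h"
  obtains C where "C > 0" "\<And>z. z \<in> sphere (complex_of_real a) 1 \<Longrightarrow> norm (h z) \<le> C"
proof -
  have "bounded (h ` sphere (complex_of_real a) 1)"
    by (intro compact_imp_bounded compact_continuous_image assms compact_sphere)
  then show ?thesis using that unfolding bounded_pos by blast
qed

lemma integrable_arc_continuous:
  fixes f :: "complex \<Rightarrow> 'b::{banach, second_countable_topology}"
  assumes "continuous_on (sphere (complex_of_real a) 1) f"
  shows "integrable (arc_length a) f"
proof -
  interpret finite_measure "arc_length a" by (rule finite_measure_arc_length)
  obtain C where "\<And>z. z \<in> sphere (complex_of_real a) 1 \<Longrightarrow> norm (f z) \<le> C"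
    using continuous_on_circle_bounded[OF assms] by blast
  then show ?thesis
    by (intro integrable_const_bound[of _ C] continuous_on_arc_measurable assms)
       (auto simp: space_arc_length)
qed

lemma borel_arc_measurable:
  "f \<in> borel \<rightarrow>\<^sub>M N \<Longrightarrow> f \<in> arc_length a \<rightarrow>\<^sub>M N"
  by (subst measurable_cong_sets[OF sets_arc_length refl]) (rule measurable_restrict_space1)

text \<open>Closing the parameter interval at \<open>2 * pi\<close> adds a null set and gives access to the
  fundamental theorem of calculus on a compact interval.\<close>

lemma integral_arc_length:
  fixes f :: "complex \<Rightarrow> 'b::{banach, second_countable_topology}"
  assumes "f \<in> borel_measurable (arc_length a)"
  shows "(LINT z|arc_length a. f z) =
    (LINT \<theta>|lborel. indicator {0..2 * pi} \<theta> *\<^sub>R f (complex_of_real a + cis \<theta>))"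
proof -
  have f: "f \<in> borel_measurable (restrict_space borel (sphere (complex_of_real a) 1))"
    using assms by (subst measurable_cong_sets[OF sets_arc_length[symmetric] refl])
  have "(LINT z|arc_length a. f z) =
    (LINT \<theta>|restrict_space lborel {0..<2 * pi}. f (complex_of_real a + cis \<theta>))"
    unfolding arc_length_def by (rule integral_distr[OF arc_parametrization_measurable f])
  also have "\<dots> = (LINT \<theta>|lborel. indicator {0..<2 * pi} \<theta> *\<^sub>R f (complex_of_real a + cis \<theta>))"
    by (rule integral_restrict_space) simp
  also have "\<dots> = (LINT \<theta>|lborel. indicator {0..2 * pi} \<theta> *\<^sub>R f (complex_of_real a + cis \<theta>))"
    by (rule integral_discrete_difference[of "{2 * pi}"]) (auto simp: indicator_def)
  finally show ?thesis .
qed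

lemma integral_arc_length_FTC:
  fixes f :: "complex \<Rightarrow> complex"
  assumes f: "continuous_on (sphere (complex_of_real a) 1) f"
    and F: "\<And>\<theta>. (F has_vector_derivative f (complex_of_real a + cis \<theta>)) (at \<theta> within {0..2 * pi})"
  shows "(LINT z|arc_length a. f z) = F (2 * pi) - F 0"
  unfolding integral_arc_length[OF continuous_on_arc_measurable[OF f]]
proof (rule integral_FTC_Icc)
  show "continuous_on {0..2 * pi} (\<lambda>\<theta>. f (complex_of_real a + cis \<theta>))"
    by (rule continuous_on_compose2[OF f]) (auto intro!: continuous_intros simp: dist_norm)
qed (use F in auto)

lemma circle_point:
  "complex_of_real a + cis \<theta> \<in> sphere (complex_of_real a) 1"
  by (simp add: dist_norm)

lemma continuous_on_disk_coord:
  assumes "a > 1"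
  shows "continuous_on (sphere (complex_of_real a) 1) (disk_coord a)"
  unfolding disk_coord_def using circle_add_focus_nonzero[OF assms] radius_pos_less_1[OF assms]
  by (intro continuous_intros) auto

text \<open>On the circle \<open>z * cnj z = 2 * a * x - c\<^sup>2\<close>; this identity is what turns the logarithmic
  derivative of the Moebius coordinate into \<open>\<i> * c / x\<close>.\<close>

lemma circle_focal_product:
  assumes "a > 1" "z \<in> sphere (complex_of_real a) 1"
  shows "(z - of_real (focus a)) * (z + of_real (focus a)) = 2 * of_real (Re z) * (z - of_real a)"
  using circle_cmod_square[OF assms]
  by (simp add: complex_eq_iff power2_eq_square algebra_simps)

text \<open>Along the circle, \<open>disk_coord a z powi n\<close> has derivative \<open>\<i> * n * (c / x)\<close> times itself, so the
  integrand has a periodic primitive.\<close>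

lemma disk_coord_moment_nonzero:
  assumes a: "a > 1" and n: "n \<noteq> (0::int)"
  shows "(LINT z|arc_length a. of_real (focus a / Re z) * disk_coord a z powi n) = 0"
proof -
  let ?c = "complex_of_real (focus a)" and ?r = "complex_of_real (radius a)"
  define F where "F \<theta> = disk_coord a (of_real a + cis \<theta>) powi n / (\<i> * of_int n)" for \<theta> :: real
  have nz: "disk_coord a z \<noteq> 0" if "z \<in> sphere (complex_of_real a) 1" for z
    using cmod_disk_coord[OF a that] by auto
  have r: "?r \<noteq> 0" using radius_pos_less_1[OF a] by simp
  have "(LINT z|arc_length a. of_real (focus a / Re z) * disk_coord a z powi n) = F (2 * pi) - F 0"
  proof (rule integral_arc_length_FTC)
    show "continuous_on (sphere (complex_of_real a) 1) (\<lambda>z. of_real (focus a / Re z) * disk_coord a z powi n)"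
      using nz circle_Re_pos[OF a] by (intro continuous_intros continuous_on_disk_coord[OF a]) fastforce+
    fix \<theta> :: real
    define z where "z = complex_of_real a + cis \<theta>"
    have z: "z \<in> sphere (complex_of_real a) 1" unfolding z_def by (rule circle_point)
    have zc: "z + ?c \<noteq> 0" by (rule circle_add_focus_nonzero[OF a z])
    have e: "exp (\<i> * complex_of_real \<theta>) = z - of_real a" by (simp add: z_def cis_conv_exp)
    then have e': "of_real a + exp (\<i> * complex_of_real \<theta>) = z" by simp
    have x: "complex_of_real (Re z) \<noteq> 0" using circle_Re_pos[OF a z] by simp
    have zc': "z - ?c \<noteq> 0" using nz[OF z] by (simp add: disk_coord_def)
    have D: "((\<lambda>u. disk_coord a (of_real a + exp (\<i> * u))) has_field_derivative
        (\<i> * (z - of_real a) * (2 * ?c) / (?r * (z + ?c)\<^sup>2))) (at (of_real \<theta>))"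
    proof -
      have "((\<lambda>u. (of_real a + exp (\<i> * u) - ?c) / (?r * (of_real a + exp (\<i> * u) + ?c))) has_field_derivative
         ((\<i> * exp (\<i> * of_real \<theta>)) * (?r * (z + ?c)) - (z - ?c) * (?r * (\<i> * exp (\<i> * of_real \<theta>)))) / ((?r * (z + ?c)) * (?r * (z + ?c))))
         (at (of_real \<theta>))"
        using zc r by (auto intro!: derivative_eq_intros simp: e')
      moreover have "((\<i> * exp (\<i> * of_real \<theta>)) * (?r * (z + ?c)) - (z - ?c) * (?r * (\<i> * exp (\<i> * of_real \<theta>))))
          = ?r * (\<i> * (z - of_real a) * (2 * ?c))" by (simp add: e algebra_simps)
      moreover have "?r * (\<i> * (z - of_real a) * (2 * ?c)) / ((?r * (z + ?c)) * (?r * (z + ?c)))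
          = \<i> * (z - of_real a) * (2 * ?c) / (?r * (z + ?c)\<^sup>2)"
        using r zc by (simp add: power2_eq_square mult_ac)
      ultimately show ?thesis unfolding disk_coord_def by (simp only:)
    qed
    have "\<i> * (z - of_real a) * (2 * ?c) / (?r * (z + ?c)\<^sup>2) = \<i> * disk_coord a z * (?c / of_real (Re z))"
    proof -
      have "\<i> * disk_coord a z * (?c / of_real (Re z)) = \<i> * ?c * ((z - ?c) * (z + ?c)) / (?r * (z + ?c)\<^sup>2 * of_real (Re z))"
        using zc by (simp add: disk_coord_def power2_eq_square mult_ac)
      also have "\<dots> = \<i> * (z - of_real a) * (2 * ?c) / (?r * (z + ?c)\<^sup>2)"
        unfolding circle_focal_product[OF a z] using x by (simp add: mult_ac)
      finally show ?thesis by simp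
    qed
    note D = D[unfolded this]
    have "((\<lambda>u. disk_coord a (of_real a + exp (\<i> * u)) powi n / (\<i> * of_int n)) has_field_derivative
       (of_int n * disk_coord a z powi (n - 1) * (\<i> * disk_coord a z * (?c / of_real (Re z))) / (\<i> * of_int n)))
       (at (of_real \<theta>))"
      using D nz[OF z] n
      by (auto intro!: derivative_eq_intros simp: e algebra_simps)
    moreover have "of_int n * disk_coord a z powi (n - 1) * (\<i> * disk_coord a z * (?c / of_real (Re z))) / (\<i> * of_int n)
        = of_real (focus a / Re z) * disk_coord a z powi n"
      using nz[OF z] n by (simp add: power_int_diff)
    ultimately have "((\<lambda>u. disk_coord a (of_real a + exp (\<i> * u)) powi n / (\<i> * of_int n)) has_field_derivative
       (of_real (focus a / Re z) * disk_coord a z powi n)) (at (of_real \<theta>))" by simp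
    from has_vector_derivative_real_field[OF this]
    show "(F has_vector_derivative of_real (focus a / Re (complex_of_real a + cis \<theta>)) *
            disk_coord a (complex_of_real a + cis \<theta>) powi n) (at \<theta> within {0..2 * pi})"
      unfolding F_def z_def by (simp add: cis_conv_exp)
  qed
  also have "\<dots> = 0" by (simp add: F_def cis_2pi)
  finally show ?thesis .
qed

text \<open>The function \<open>c / x\<close> is the Poisson kernel \<open>Re ((1 - u) / (1 + u))\<close> with \<open>u = r * cis \<theta>\<close>, and
  \<open>\<theta> + 2 * \<i> * Ln (1 + u)\<close> is a primitive of \<open>(1 - u) / (1 + u)\<close>.  The logarithm is periodic as
  \<open>cmod u < 1\<close>, so only \<open>\<theta>\<close> contributes to the integral.\<close>

lemma angle_measure_total:
  assumes a: "a > 1"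
  shows "(LINT z|arc_length a. focus a / Re z) = 2 * pi"
proof -
  let ?r = "complex_of_real (radius a)"
  note r = radius_pos_less_1[OF a]
  define f where "f z = (1 - ?r * (z - of_real a)) / (1 + ?r * (z - of_real a))" for z
  define F where "F \<theta> = of_real \<theta> + 2 * \<i> * Ln (1 + ?r * cis \<theta>)" for \<theta> :: real
  have pos: "0 < Re (1 + ?r * (z - of_real a))" if "z \<in> sphere (complex_of_real a) 1" for z
  proof -
    have "radius a * (Re z - a) \<ge> radius a * (- 1)"
      using circle_Re_bounds(1)[OF that] r by (intro mult_left_mono) auto
    then show ?thesis using r by simp
  qed
  then have nz: "1 + ?r * (z - of_real a) \<noteq> 0" if "z \<in> sphere (complex_of_real a) 1" for z
    using that by (metis less_irrefl zero_complex.sel(1))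
  have cf: "continuous_on (sphere (complex_of_real a) 1) f"
    unfolding f_def using nz by (intro continuous_intros) auto
  have "(LINT z|arc_length a. f z) = F (2 * pi) - F 0"
  proof (rule integral_arc_length_FTC[OF cf])
    fix \<theta> :: real
    define z where "z = complex_of_real a + cis \<theta>"
    have z: "z \<in> sphere (complex_of_real a) 1" unfolding z_def by (rule circle_point)
    have e: "exp (\<i> * complex_of_real \<theta>) = z - of_real a" by (simp add: z_def cis_conv_exp)
    have "1 + ?r * (z - of_real a) \<notin> \<real>\<^sub>\<le>\<^sub>0"
      using pos[OF z] by (auto simp: complex_nonpos_Reals_iff)
    then have "((\<lambda>u. u + 2 * \<i> * Ln (1 + ?r * exp (\<i> * u))) has_field_derivative
        (1 + 2 * \<i> * ((?r * (\<i> * (z - of_real a))) / (1 + ?r * (z - of_real a))))) (at (of_real \<theta>))"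
      by (auto intro!: derivative_eq_intros simp: e field_simps)
    moreover have "1 + 2 * \<i> * ((?r * (\<i> * (z - of_real a))) / (1 + ?r * (z - of_real a))) = f z"
    proof -
      have "2 * \<i> * (?r * (\<i> * (z - of_real a))) = - 2 * (?r * (z - of_real a))"
        by (simp add: complex_eq_iff)
      then have "1 + 2 * \<i> * ((?r * (\<i> * (z - of_real a))) / (1 + ?r * (z - of_real a)))
         = 1 + - 2 * (?r * (z - of_real a)) / (1 + ?r * (z - of_real a))" by (simp add: mult_ac)
      also have "\<dots> = f z" unfolding f_def using nz[OF z] by (simp add: field_simps)
      finally show ?thesis .
    qed
    ultimately have "((\<lambda>u. u + 2 * \<i> * Ln (1 + ?r * exp (\<i> * u))) has_field_derivative f z) (at (of_real \<theta>))"
      by simp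
    from has_vector_derivative_real_field[OF this]
    show "(F has_vector_derivative f (complex_of_real a + cis \<theta>)) (at \<theta> within {0..2 * pi})"
      unfolding F_def z_def by (simp add: cis_conv_exp)
  qed
  also have "\<dots> = 2 * pi" by (simp add: F_def)
  finally have If: "(LINT z|arc_length a. f z) = 2 * pi" .
  have i: "integrable (arc_length a) f" by (rule integrable_arc_continuous[OF cf])
  have "(LINT z|arc_length a. focus a / Re z) = (LINT z|arc_length a. Re (f z))"
  proof (rule Bochner_Integration.integral_cong[OF refl])
    fix z assume "z \<in> space (arc_length a)"
    then have z: "z \<in> sphere (complex_of_real a) 1" by (simp add: space_arc_length)
    define u where "u = ?r * (z - of_real a)"
    have u: "cmod u = radius a" using z r by (simp add: u_def norm_mult dist_norm norm_minus_commute)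
    have "(cmod (1 + u))\<^sup>2 = 1 + 2 * Re u + (cmod u)\<^sup>2"
      by (simp add: cmod_power2 power2_sum)
    also have "\<dots> = 2 * radius a * Re z"
      unfolding u focus_radius(5)[OF a] by (simp add: u_def algebra_simps)
    finally have d: "(cmod (1 + u))\<^sup>2 = 2 * radius a * Re z" .
    have "Re (f z) = Re ((1 - u) * cnj (1 + u) / of_real ((cmod (1 + u))\<^sup>2))"
      unfolding f_def u_def by (metis complex_div_cnj)
    also have "\<dots> = Re ((1 - u) * cnj (1 + u)) / (2 * radius a * Re z)"
      by (simp only: Re_divide_of_real d)
    also have "Re ((1 - u) * cnj (1 + u)) = 1 - (cmod u)\<^sup>2"
      by (simp add: cmod_power2) (simp add: algebra_simps power2_eq_square)
    also have "\<dots> = 2 * radius a * focus a" unfolding u by (rule focus_radius(6)[OF a])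
    finally show "focus a / Re z = Re (f z)" using r by simp
  qed
  also have "\<dots> = Re (LINT z|arc_length a. f z)" using i by simp
  finally show ?thesis by (simp add: If)
qed

lemma measurable_Re_arc: "(\<lambda>z. focus a / Re z) \<in> borel_measurable (arc_length a)"
  by (rule borel_arc_measurable) measurable

lemma integral_angle_measure:
  fixes f :: "complex \<Rightarrow> 'b::{banach, second_countable_topology}"
  assumes "a > 1" and f: "f \<in> borel_measurable (arc_length a)"
  shows "integral\<^sup>L (angle_measure a) f = (LINT z|arc_length a. (focus a / Re z) *\<^sub>R f z)"
    and "integrable (angle_measure a) f \<longleftrightarrow> integrable (arc_length a) (\<lambda>z. (focus a / Re z) *\<^sub>R f z)"
proof -
  have nn: "AE z in arc_length a. 0 \<le> focus a / Re z"
    using circle_Re_pos[OF assms(1)] focus_radius(1)[OF assms(1)]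
    by (intro AE_I2) (auto simp: space_arc_length intro: less_imp_le)
  show "integral\<^sup>L (angle_measure a) f = (LINT z|arc_length a. (focus a / Re z) *\<^sub>R f z)"
    unfolding angle_measure_def by (rule integral_density[OF f measurable_Re_arc nn])
  show "integrable (angle_measure a) f \<longleftrightarrow> integrable (arc_length a) (\<lambda>z. (focus a / Re z) *\<^sub>R f z)"
    unfolding angle_measure_def by (rule integrable_density[OF f measurable_Re_arc nn])
qed

lemma sets_angle_measure: "sets (angle_measure a) = sets (arc_length a)"
  and space_angle_measure: "space (angle_measure a) = sphere (complex_of_real a) 1"
  by (simp_all add: angle_measure_def space_arc_length)

text \<open>The coordinate is injective with the Borel measurable inverse of \<open>disk_coord_inverse\<close>, hence
  it generates the Borel sets of the circle.\<close>

lemma unitary_coordinate_disk_coord: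
  assumes a: "a > 1"
  shows "unitary_coordinate (angle_measure a) (disk_coord a)"
proof -
  interpret A: finite_measure "arc_length a" by (rule finite_measure_arc_length)
  have nn: "AE z in arc_length a. 0 \<le> focus a / Re z"
    using circle_Re_pos[OF a] focus_radius(1)[OF a]
    by (intro AE_I2) (auto simp: space_arc_length intro: less_imp_le)
  have m: "disk_coord a \<in> borel_measurable (arc_length a)"
    by (rule continuous_on_arc_measurable[OF continuous_on_disk_coord[OF a]])
  have mp: "(\<lambda>z. disk_coord a z powi n) \<in> borel_measurable (arc_length a)" for n
    using m unfolding power_int_def by measurable
  show ?thesis
  proof (intro unitary_coordinate.intro unitary_coordinate_axioms.intro finite_measureI)
    have "integrable (arc_length a) (\<lambda>z. focus a / Re z)"
      using angle_measure_total[OF a] not_integrable_integral_eq by fastforce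
    then have "emeasure (angle_measure a) (space (angle_measure a)) = ennreal (2 * pi)"
      unfolding angle_measure_def using measurable_Re_arc[of a] nn
      by (simp add: emeasure_density nn_integral_eq_integral angle_measure_total[OF a] cong: nn_integral_cong)
    then show "emeasure (angle_measure a) (space (angle_measure a)) \<noteq> \<infinity>" by simp
    show "disk_coord a \<in> borel_measurable (angle_measure a)"
      using m by (simp add: angle_measure_def)
    show "cmod (disk_coord a z) = 1" if "z \<in> space (angle_measure a)" for z
      using cmod_disk_coord[OF a] that by (simp add: space_angle_measure)
    show "\<exists>B\<in>sets borel. A = disk_coord a -` B \<inter> space (angle_measure a)"
      if "A \<in> sets (angle_measure a)" for A
    proof -
      have "A \<in> (\<inter>) (sphere (complex_of_real a) 1) ` sets borel"
        using that by (simp only: sets_angle_measure sets_arc_length sets_restrict_space)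
      then obtain B where B: "B \<in> sets borel" "A = sphere (complex_of_real a) 1 \<inter> B"
        by (rule imageE) metis
      define g where "g v = of_real (focus a) * (1 + of_real (radius a) * v) / (1 - of_real (radius a) * v)"
        for v :: complex
      have "g \<in> borel_measurable borel" unfolding g_def by measurable
      then have "g -` B \<in> sets borel" using B(1) by (simp add: in_borel_measurable_borel)
      moreover have "A = disk_coord a -` (g -` B) \<inter> space (angle_measure a)"
        using disk_coord_inverse[OF a] by (auto simp: B(2) space_angle_measure g_def)
      ultimately show ?thesis by blast
    qed
    show "(LINT z|angle_measure a. disk_coord a z powi n) = (if n = 0 then 2 * pi else 0)" for n :: int
    proof (cases "n = 0")
      case True
      then have "(LINT z|angle_measure a. disk_coord a z powi n) = (LINT z|arc_length a. of_real (focus a / Re z))"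
        by (subst integral_angle_measure(1)[OF a mp]) (simp add: scaleR_conv_of_real)
      also have "\<dots> = of_real (2 * pi)"
        by (subst integral_complex_of_real) (simp only: angle_measure_total[OF a])
      finally show ?thesis using True by simp
    next
      case False
      then show ?thesis
        using disk_coord_moment_nonzero[OF a False]
        by (subst integral_angle_measure(1)[OF a mp]) (simp add: scaleR_conv_of_real)
    qed
  qed
qed

section \<open>Recovering a function from its transform\<close>

lemma L2_circle_measurable: "L2_circle a g \<Longrightarrow> g \<in> borel_measurable (arc_length a)"
  by (simp add: L2_circle_def)

lemma L2_circle_integrable:
  assumes "L2_circle a g"
  shows "integrable (arc_length a) g"
  using assms unfolding L2_circle_def
  by (elim conjE) (rule finite_measure.square_integrable_imp_integrable[OF finite_measure_arc_length])

lemma integrable_continuous_mult: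
  fixes h :: "complex \<Rightarrow> complex" and q :: "complex \<Rightarrow> complex"
  assumes h: "continuous_on (sphere (complex_of_real a) 1) h" and q: "integrable (arc_length a) q"
  shows "integrable (arc_length a) (\<lambda>z. h z * q z)"
proof -
  obtain C where C: "C > 0" "\<And>z. z \<in> sphere (complex_of_real a) 1 \<Longrightarrow> cmod (h z) \<le> C"
    using continuous_on_circle_bounded[OF h] by blast
  have [measurable]: "h \<in> borel_measurable (arc_length a)" "q \<in> borel_measurable (arc_length a)"
    using continuous_on_arc_measurable[OF h] q by auto
  show ?thesis
  proof (rule Bochner_Integration.integrable_bound)
    show "integrable (arc_length a) (\<lambda>z. C * norm (q z))" using q by simp
    show "AE z in arc_length a. norm (h z * q z) \<le> norm (C * norm (q z))"
      using C by (intro AE_I2) (auto simp: space_arc_length norm_mult intro!: mult_right_mono)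
  qed measurable
qed

lemma integrable_continuous_mult_L2:
  fixes h :: "complex \<Rightarrow> complex"
  assumes "continuous_on (sphere (complex_of_real a) 1) h" "L2_circle a g"
  shows "integrable (arc_length a) (\<lambda>z. h z * of_real (g z))"
  by (intro integrable_continuous_mult assms(1)) (simp add: L2_circle_integrable[OF assms(2)])

lemma L2_circle_continuous_mult:
  assumes h: "continuous_on (sphere (complex_of_real a) 1) h" and g: "L2_circle a g"
  shows "L2_circle a (\<lambda>z. h z * g z)"
proof -
  obtain C where C: "C > 0" "\<And>z. z \<in> sphere (complex_of_real a) 1 \<Longrightarrow> \<bar>h z\<bar> \<le> C"
    using continuous_on_circle_bounded[OF h] by (metis real_norm_def)
  have [measurable]: "h \<in> borel_measurable (arc_length a)" "g \<in> borel_measurable (arc_length a)"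
    using continuous_on_arc_measurable[OF h] L2_circle_measurable[OF g] by auto
  have "integrable (arc_length a) (\<lambda>z. (h z * g z)\<^sup>2)"
  proof (rule Bochner_Integration.integrable_bound)
    show "integrable (arc_length a) (\<lambda>z. C\<^sup>2 * (g z)\<^sup>2)" using g by (simp add: L2_circle_def)
    show "AE z in arc_length a. norm ((h z * g z)\<^sup>2) \<le> norm (C\<^sup>2 * (g z)\<^sup>2)"
      using C power_mono[OF C(2), of _ 2]
      by (intro AE_I2) (auto simp: space_arc_length power_mult_distrib intro!: mult_right_mono)
  qed measurable
  then show ?thesis unfolding L2_circle_def by simp
qed

text \<open>The kernel is bounded by \<open>(1 - radius a) ^ (- 2 * M)\<close>, which dominates the double integral by
  the integral of \<open>cmod (q z)\<close>.\<close>

lemma poisson_integral_Fubini: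
  fixes q :: "complex \<Rightarrow> complex" and n :: int
  assumes a: "a > 1" and M: "M \<ge> 1" and q: "integrable (arc_length a) q"
  shows "(LINT t|angle_space. cis (- of_int n * t) *
      (LINT z|arc_length a. q z / of_real (cmod (cis t - of_real (radius a) * disk_coord a z) ^ (2 * M))))
    = 2 * pi * poisson_coeff a M n * (LINT z|arc_length a. q z * disk_coord a z powi (- n))"
proof -
  note r = radius_pos_less_1[OF a]
  interpret A: finite_measure "arc_length a" by (rule finite_measure_arc_length)
  interpret P: pair_sigma_finite angle_space "arc_length a" ..
  define K where "K t z = complex_of_real (cmod (cis t - of_real (radius a) * disk_coord a z) ^ (2 * M))" for t z
  define f where "f t z = cis (- of_int n * t) * (q z / K t z)" for t z
  have [measurable]: "q \<in> borel_measurable (arc_length a)" using q by simp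
  have [measurable]: "disk_coord a \<in> borel_measurable (arc_length a)"
    by (rule continuous_on_arc_measurable[OF continuous_on_disk_coord[OF a]])
  have [measurable]: "cis \<in> borel_measurable angle_space" "(\<lambda>t. cis (c * t)) \<in> borel_measurable angle_space" for c
    using angle_measurable[OF cis_measurable[of 1]] angle_measurable[OF cis_measurable] by auto
  have fm [measurable]: "case_prod f \<in> borel_measurable (angle_space \<Otimes>\<^sub>M arc_length a)"
    unfolding f_def K_def by measurable
  have qi: "integrable (angle_space \<Otimes>\<^sub>M arc_length a) (\<lambda>p. q (snd p))"
    by (rule P.Fubini_integrable) (use q in auto)
  have fi: "integrable (angle_space \<Otimes>\<^sub>M arc_length a) (case_prod f)"
  proof (rule Bochner_Integration.integrable_bound[OF _ fm])
    show "integrable (angle_space \<Otimes>\<^sub>M arc_length a) (\<lambda>p. norm (q (snd p)) / (1 - radius a) ^ (2 * M))"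
      using qi by simp
    show "AE p in angle_space \<Otimes>\<^sub>M arc_length a. norm (case_prod f p)
        \<le> norm (norm (q (snd p)) / (1 - radius a) ^ (2 * M))"
    proof (rule AE_I2)
      fix p assume "p \<in> space (angle_space \<Otimes>\<^sub>M arc_length a)"
      then obtain t z where p: "p = (t, z)" and z: "z \<in> sphere (complex_of_real a) 1"
        by (auto simp: space_pair_measure space_arc_length)
      have "1 - radius a \<le> cmod (cis t - of_real (radius a) * disk_coord a z)"
        using norm_triangle_ineq2[of "cis t" "of_real (radius a) * disk_coord a z"] r
        by (simp add: norm_mult cmod_disk_coord[OF a z])
      then have "(1 - radius a) ^ (2 * M) \<le> cmod (K t z)"
        unfolding K_def using r by (simp add: norm_power power_mono)
      then show "norm (case_prod f p) \<le> norm (norm (q (snd p)) / (1 - radius a) ^ (2 * M))"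
        using r by (simp add: p f_def norm_mult norm_divide frac_le)
    qed
  qed
  have "(LINT t|angle_space. cis (- of_int n * t) * (LINT z|arc_length a. q z / K t z))
      = (LINT t|angle_space. (LINT z|arc_length a. f t z))"
    by (simp only: f_def integral_mult_right_zero)
  also have "\<dots> = (LINT z|arc_length a. (LINT t|angle_space. f t z))"
    by (rule P.Fubini_integral[OF fi, symmetric])
  also have "\<dots> = (LINT z|arc_length a. (2 * pi * poisson_coeff a M n) * (q z * disk_coord a z powi (- n)))"
  proof (rule Bochner_Integration.integral_cong[OF refl])
    fix z assume "z \<in> space (arc_length a)"
    then have v: "cmod (disk_coord a z) = 1" using cmod_disk_coord[OF a] by (simp add: space_arc_length)
    have "(LINT t|angle_space. f t z) = (LINT t|angle_space. q z * (cis (- of_int n * t) / K t z))"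
      by (rule Bochner_Integration.integral_cong[OF refl]) (simp add: f_def)
    also have "\<dots> = q z * (LINT t|angle_space. cis (- of_int n * t) / K t z)"
      by (rule integral_mult_right_zero)
    also have "(LINT t|angle_space. cis (- of_int n * t) / K t z)
        = 2 * pi * poisson_coeff a M n * disk_coord a z powi (- n)"
      unfolding K_def by (rule poisson_integral[OF a M v])
    finally show "(LINT t|angle_space. f t z)
        = (2 * pi * poisson_coeff a M n) * (q z * disk_coord a z powi (- n))" by (simp add: mult_ac)
  qed
  also have "\<dots> = 2 * pi * poisson_coeff a M n * (LINT z|arc_length a. q z * disk_coord a z powi (- n))"
    by (rule integral_mult_right_zero)
  finally show ?thesis by (simp only: K_def)
qed

lemma cis_eq_1_interior:
  assumes "0 < t" "t < 2 * pi"
  shows "cis t \<noteq> 1"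
proof
  assume "cis t = 1"
  then have "cos t = 1" by (simp add: complex_eq_iff)
  then show False
    using cos_monotone_0_pi[of 0 t] cos_monotone_0_pi[of 0 "2 * pi - t"] assms
    by (cases "t \<le> pi") (auto simp: cos_diff)
qed

text \<open>The prefactor in \<open>inversion_coeff\<close> cancels the part of \<open>kern k z ^ M\<close> that depends on \<open>k\<close> only.
  What remains is the convolution with the Poisson type kernel, whose Fourier coefficients
  factor; the weights \<open>c / x\<close> of the angular measure and \<open>x powi (2 - M)\<close> of \<open>G\<close> combine to
  \<open>c * x powi (1 - M)\<close>.\<close>

lemma inversion_coeff_eq:
  fixes n :: int
  assumes a: "a > 1" and M: "M \<ge> 1" and g: "L2_circle a g"
    and \<Phi>: "\<And>k. k \<in> exterior_domain a \<Longrightarrow>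
       \<Phi> k = (LINT z|arc_length a. of_real (Re z) * of_real (g z) / kern k z ^ M)"
  shows "inversion_coeff a M \<Phi> n = unitary_coordinate.fourier_coeff (angle_measure a) (disk_coord a)
    (\<lambda>z. of_real (Re z powi (2 - int M) * g z)) n"
proof -
  note r = radius_pos_less_1[OF a]
  interpret U: unitary_coordinate "angle_measure a" "disk_coord a"
    by (rule unitary_coordinate_disk_coord[OF a])
  have nz: "\<forall>z\<in>sphere (complex_of_real a) 1. Re z \<noteq> 0" using circle_Re_pos[OF a] by fastforce
  define q where "q z = complex_of_real (focus a * Re z powi (1 - int M)) * of_real (g z)" for z
  have qi: "integrable (arc_length a) q"
    unfolding q_def
    by (rule integrable_continuous_mult_L2[OF _ g]) (use nz in \<open>intro continuous_intros; auto\<close>)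
  define E where "E t = of_real (focus a) * (2 * cis t / (of_real (radius a) * (1 - cis t)\<^sup>2)) ^ M *
        \<Phi> (of_real (focus a) * (1 + cis t) / (1 - cis t)) * cis (- of_int n * t)" for t
  define H where "H t = (LINT z|arc_length a. q z /
      of_real (cmod (cis t - of_real (radius a) * disk_coord a z) ^ (2 * M)))" for t
  have EH: "E t = cis (- of_int n * t) * H t" if t: "0 < t" "t < 2 * pi" for t
  proof -
    define \<kappa> where "\<kappa> = cis t"
    have \<kappa>: "cmod \<kappa> = 1" "\<kappa> \<noteq> 1" "\<kappa> \<noteq> 0" using cis_eq_1_interior[OF t] by (auto simp: \<kappa>_def)
    define L where "L = 2 * \<kappa> / (of_real (radius a) * (1 - \<kappa>)\<^sup>2)"
    have L: "L \<noteq> 0" using \<kappa> r by (simp add: L_def)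
    have "of_real (focus a) * L ^ M * \<Phi> (cayley_point a \<kappa>)
        = (LINT z|arc_length a. (of_real (focus a) * L ^ M) * (of_real (Re z) * of_real (g z) / kern (cayley_point a \<kappa>) z ^ M))"
      unfolding \<Phi>[OF cayley_point_exterior[OF a \<kappa>(1)]] by (rule integral_mult_right_zero[symmetric])
    also have "\<dots> = H t"
      unfolding H_def
    proof (rule Bochner_Integration.integral_cong[OF refl])
      fix z assume "z \<in> space (arc_length a)"
      then have z: "z \<in> sphere (complex_of_real a) 1" by (simp add: space_arc_length)
      define D where "D = complex_of_real ((cmod (\<kappa> - of_real (radius a) * disk_coord a z))\<^sup>2)"
      have x: "complex_of_real (Re z) \<noteq> 0" using circle_Re_pos[OF a z] by simp
      have "kern (cayley_point a \<kappa>) z = L * (of_real (Re z) * D)"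
        unfolding kern_cayley_point[OF a z \<kappa>(1,2)] L_def D_def by (simp add: mult_ac)
      then have "kern (cayley_point a \<kappa>) z ^ M = L ^ M * (of_real (Re z) ^ M * D ^ M)"
        by (simp add: power_mult_distrib)
      then have "(of_real (focus a) * L ^ M) * (of_real (Re z) * of_real (g z) / kern (cayley_point a \<kappa>) z ^ M)
         = of_real (focus a) * (of_real (Re z) / of_real (Re z) ^ M) * of_real (g z) / D ^ M"
        using L by simp
      also have "of_real (Re z) / of_real (Re z) ^ M = complex_of_real (Re z powi (1 - int M))"
        using x by (simp add: power_int_diff)
      also have "D ^ M = of_real (cmod (cis t - of_real (radius a) * disk_coord a z) ^ (2 * M))"
        by (simp add: D_def \<kappa>_def power_mult)
      finally show "(of_real (focus a) * L ^ M) * (of_real (Re z) * of_real (g z) / kern (cayley_point a \<kappa>) z ^ M)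
         = q z / of_real (cmod (cis t - of_real (radius a) * disk_coord a z) ^ (2 * M))"
        by (simp add: q_def)
    qed
    finally show ?thesis unfolding E_def L_def \<kappa>_def cayley_point_def by (simp add: mult.commute)
  qed
  have "(LINT t:{0..2 * pi}|lborel. E t) = (LINT t|angle_space. E t)"
    by (rule set_integral_angle_space)
  also have "\<dots> = (LINT t|angle_space. cis (- of_int n * t) * H t)"
  \<comment> \<open>the end points, where \<open>cis t = 1\<close> and \<open>k\<close> would be infinite, form a null set\<close>
  proof (rule integral_discrete_difference[of "{0, 2 * pi}"])
    show "E t = cis (- of_int n * t) * H t" if "t \<in> space angle_space" "t \<notin> {0, 2 * pi}" for t
      using that by (intro EH) (auto simp: space_angle_space)
  qed (auto simp: angle_space_def emeasure_restrict_space sets_restrict_space_iff)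
  also have "\<dots> = 2 * pi * poisson_coeff a M n * (LINT z|arc_length a. q z * disk_coord a z powi (- n))"
    unfolding H_def by (rule poisson_integral_Fubini[OF a M qi])
  finally have "inversion_coeff a M \<Phi> n
      = 2 * pi * poisson_coeff a M n * (LINT z|arc_length a. q z * disk_coord a z powi (- n)) / of_real (4 * pi\<^sup>2 * poisson_coeff a M n)"
    by (simp only: inversion_coeff_def E_def)
  also have "\<dots> = (LINT z|arc_length a. q z * disk_coord a z powi (- n)) / (2 * pi)"
    using poisson_coeff_pos[OF a M, of n] by (simp add: power2_eq_square)
  also have "(LINT z|arc_length a. q z * disk_coord a z powi (- n))
     = (LINT z|angle_measure a. of_real (Re z powi (2 - int M) * g z) * disk_coord a z powi (- n))"
  proof -
    have [measurable]: "(\<lambda>z. Re z powi (2 - int M)) \<in> borel_measurable (arc_length a)"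
      by (rule continuous_on_arc_measurable) (use nz in \<open>intro continuous_intros; auto\<close>)
    have [measurable]: "g \<in> borel_measurable (arc_length a)" by (rule L2_circle_measurable[OF g])
    have [measurable]: "(\<lambda>z. disk_coord a z powi (- n)) \<in> borel_measurable (arc_length a)"
      using U.coordinate_powi_measurable[of "- n"] by (simp add: angle_measure_def)
    have m: "(\<lambda>z. complex_of_real (Re z powi (2 - int M) * g z) * disk_coord a z powi (- n)) \<in> borel_measurable (arc_length a)"
      by measurable
    show ?thesis unfolding integral_angle_measure(1)[OF a m]
    proof (rule Bochner_Integration.integral_cong[OF refl])
      fix z assume "z \<in> space (arc_length a)"
      then have x: "Re z \<noteq> 0" using nz by (simp add: space_arc_length)
      have "1 - int M = (2 - int M) - 1" by simp
      then have "Re z powi (1 - int M) = Re z powi (2 - int M) / Re z"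
        using x by (metis power_int_diff power_int_1_right)
      then show "q z * disk_coord a z powi (- n) = (focus a / Re z) *\<^sub>R
          (complex_of_real (Re z powi (2 - int M) * g z) * disk_coord a z powi (- n))"
        by (simp add: q_def scaleR_conv_of_real)
    qed
  qed
  finally show ?thesis by (simp only: U.fourier_coeff_def)
qed

lemma L2_circle_tendsto_cong:
  assumes "L2_circle_tendsto a F f"
    and "\<And>N z. z \<in> sphere (complex_of_real a) 1 \<Longrightarrow> F' N z = F N z"
    and "\<And>z. z \<in> sphere (complex_of_real a) 1 \<Longrightarrow> f' z = f z"
  shows "L2_circle_tendsto a F' f'"
proof -
  have "integrable (arc_length a) (\<lambda>z. (cmod (F' N z - of_real (f' z)))\<^sup>2)
      \<longleftrightarrow> integrable (arc_length a) (\<lambda>z. (cmod (F N z - of_real (f z)))\<^sup>2)" for N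
    by (rule Bochner_Integration.integrable_cong) (simp_all add: assms(2,3) space_arc_length)
  moreover have "(LINT z|arc_length a. (cmod (F' N z - of_real (f' z)))\<^sup>2)
      = (LINT z|arc_length a. (cmod (F N z - of_real (f z)))\<^sup>2)" for N
    by (rule Bochner_Integration.integral_cong) (simp_all add: assms(2,3) space_arc_length)
  ultimately show ?thesis using assms(1) unfolding L2_circle_tendsto_def by simp
qed

lemma L2_circle_tendsto_mult:
  assumes F: "L2_circle_tendsto a F f" and h: "continuous_on (sphere (complex_of_real a) 1) h"
  shows "L2_circle_tendsto a (\<lambda>N z. of_real (h z) * F N z) (\<lambda>z. h z * f z)"
proof -
  obtain C where C: "C > 0" "\<And>z. z \<in> sphere (complex_of_real a) 1 \<Longrightarrow> \<bar>h z\<bar> \<le> C"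
    using continuous_on_circle_bounded[OF h] by (metis real_norm_def)
  have [measurable]: "h \<in> borel_measurable (arc_length a)" by (rule continuous_on_arc_measurable[OF h])
  define e where "e N z = (cmod (F N z - of_real (f z)))\<^sup>2" for N z
  have ei: "integrable (arc_length a) (e N)" for N
    using F by (simp add: L2_circle_tendsto_def e_def[abs_def])
  then have [measurable]: "e N \<in> borel_measurable (arc_length a)" for N by auto
  have lim: "(\<lambda>N. LINT z|arc_length a. e N z) \<longlonglongrightarrow> 0"
    using F by (simp add: L2_circle_tendsto_def e_def)
  have eq: "(cmod (of_real (h z) * F N z - of_real (h z * f z)))\<^sup>2 = (h z)\<^sup>2 * e N z" for N z
  proof -
    have "of_real (h z) * F N z - of_real (h z * f z) = of_real (h z) * (F N z - of_real (f z))"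
      by (simp add: algebra_simps)
    then show ?thesis by (simp add: e_def norm_mult power_mult_distrib)
  qed
  have le: "(h z)\<^sup>2 * e N z \<le> C\<^sup>2 * e N z" if "z \<in> space (arc_length a)" for N z
    using power_mono[OF C(2), of z 2] that
    by (intro mult_right_mono) (auto simp: e_def space_arc_length)
  have i: "integrable (arc_length a) (\<lambda>z. (h z)\<^sup>2 * e N z)" for N
  proof (rule Bochner_Integration.integrable_bound)
    show "integrable (arc_length a) (\<lambda>z. C\<^sup>2 * e N z)" using ei by simp
    show "AE z in arc_length a. norm ((h z)\<^sup>2 * e N z) \<le> norm (C\<^sup>2 * e N z)"
      using le by (intro AE_I2) (simp add: e_def)
  qed measurable
  have "(\<lambda>N. LINT z|arc_length a. (h z)\<^sup>2 * e N z) \<longlonglongrightarrow> 0"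
  proof (rule tendsto_sandwich[OF _ _ tendsto_const])
    show "(\<lambda>N. C\<^sup>2 * (LINT z|arc_length a. e N z)) \<longlonglongrightarrow> 0"
      using tendsto_mult[OF tendsto_const lim, of "C\<^sup>2"] by simp
    show "\<forall>\<^sub>F N in sequentially. (LINT z|arc_length a. (h z)\<^sup>2 * e N z) \<le> C\<^sup>2 * (LINT z|arc_length a. e N z)"
    proof (rule always_eventually, rule allI)
      fix N
      have "(LINT z|arc_length a. (h z)\<^sup>2 * e N z) \<le> (LINT z|arc_length a. C\<^sup>2 * e N z)"
        using le i ei by (intro integral_mono) auto
      then show "(LINT z|arc_length a. (h z)\<^sup>2 * e N z) \<le> C\<^sup>2 * (LINT z|arc_length a. e N z)" by simp
    qed
    show "\<forall>\<^sub>F N in sequentially. 0 \<le> (LINT z|arc_length a. (h z)\<^sup>2 * e N z)"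
      by (simp add: e_def)
  qed
  with i show ?thesis unfolding L2_circle_tendsto_def eq by blast
qed

lemma L2_circle_tendsto_unique:
  assumes "L2_circle_tendsto a F f" "L2_circle_tendsto a F g"
    and f: "L2_circle a f" and g: "L2_circle a g"
  shows "AE z in arc_length a. f z = g z"
proof -
  have [measurable]: "f \<in> borel_measurable (arc_length a)" "g \<in> borel_measurable (arc_length a)"
    using f g by (simp_all add: L2_circle_measurable)
  let ?e = "\<lambda>f N z. (cmod (F N z - of_real (f z)))\<^sup>2"
  have ef: "integrable (arc_length a) (?e f N)" "integrable (arc_length a) (?e g N)" for N
    using assms(1,2) unfolding L2_circle_tendsto_def by auto
  have le: "(f z - g z)\<^sup>2 \<le> 2 * ?e f N z + 2 * ?e g N z" for N z
  proof -
    have "(cmod ((of_real (f z) - F N z) + (F N z - of_real (g z))))\<^sup>2 \<le> 2 * ?e f N z + 2 * ?e g N z"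
      using cmod_add_square_le[of "of_real (f z) - F N z" "F N z - of_real (g z)"]
      by (simp add: norm_minus_commute)
    moreover have "cmod (of_real (f z) - of_real (g z)) = \<bar>f z - g z\<bar>" by (simp flip: of_real_diff)
    ultimately show ?thesis by simp
  qed
  have i: "integrable (arc_length a) (\<lambda>z. (f z - g z)\<^sup>2)"
    by (rule Bochner_Integration.integrable_bound[of _ "\<lambda>z. 2 * ?e f 0 z + 2 * ?e g 0 z"])
       (use ef le in auto)
  have "(LINT z|arc_length a. (f z - g z)\<^sup>2)
      \<le> 2 * (LINT z|arc_length a. ?e f N z) + 2 * (LINT z|arc_length a. ?e g N z)" for N
  proof -
    have "(LINT z|arc_length a. (f z - g z)\<^sup>2) \<le> (LINT z|arc_length a. 2 * ?e f N z + 2 * ?e g N z)"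
      using i ef le by (intro integral_mono) auto
    then show ?thesis using ef by simp
  qed
  moreover have "(\<lambda>N. 2 * (LINT z|arc_length a. ?e f N z) + 2 * (LINT z|arc_length a. ?e g N z)) \<longlonglongrightarrow> 2 * 0 + 2 * 0"
    using assms(1,2) unfolding L2_circle_tendsto_def by (intro tendsto_intros) auto
  ultimately have "(LINT z|arc_length a. (f z - g z)\<^sup>2) \<le> 0"
    using LIMSEQ_le_const[of _ "2 * 0 + 2 * 0 :: real"] by fastforce
  moreover have "0 \<le> (LINT z|arc_length a. (f z - g z)\<^sup>2)" by simp
  ultimately have "AE z in arc_length a. (f z - g z)\<^sup>2 = 0"
    using integral_nonneg_eq_0_iff_AE[OF i] by simp
  then show ?thesis by simp
qed

text \<open>Convergence holds for \<open>G = x powi (2 - M) * g\<close> in the mean with respect to the angular measure.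
  Since \<open>x\<close> is bounded and bounded away from \<open>0\<close> on the circle, arc length gives an equivalent
  distance, and multiplication by \<open>x powi (M - 2)\<close> preserves convergence.\<close>

lemma inversion_series_tendsto:
  assumes a: "a > 1" and M: "M \<ge> 1" and g: "L2_circle a g"
    and \<Phi>: "\<And>k. k \<in> exterior_domain a \<Longrightarrow>
       \<Phi> k = (LINT z|arc_length a. of_real (Re z) * of_real (g z) / kern k z ^ M)"
  shows "L2_circle_tendsto a (inversion_series a M \<Phi>) g"
proof -
  interpret U: unitary_coordinate "angle_measure a" "disk_coord a"
    by (rule unitary_coordinate_disk_coord[OF a])
  note c = focus_radius(1)[OF a]
  have nz: "\<forall>z\<in>sphere (complex_of_real a) 1. Re z \<noteq> 0" using circle_Re_pos[OF a] by fastforce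
  have cont: "continuous_on (sphere (complex_of_real a) 1) (\<lambda>z. Re z powi j)" for j
    using nz by (intro continuous_intros) auto
  define G where "G z = Re z powi (2 - int M) * g z" for z
  have G: "L2_circle a G"
    unfolding G_def by (rule L2_circle_continuous_mult[OF cont g])
  have [measurable]: "G \<in> borel_measurable (arc_length a)" by (rule L2_circle_measurable[OF G])
  have cb: "continuous_on (sphere (complex_of_real a) 1) (\<lambda>z. complex_of_real (focus a / Re z))"
    using nz by (intro continuous_intros) auto
  have Gi: "integrable (angle_measure a) (\<lambda>z. (cmod (of_real (G z)))\<^sup>2)"
  proof -
    have "integrable (arc_length a) (\<lambda>z. of_real (focus a / Re z) * complex_of_real ((G z)\<^sup>2))"
      using G by (intro integrable_continuous_mult[OF cb] integrable_of_real) (simp add: L2_circle_def)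
    then have "integrable (arc_length a) (\<lambda>z. complex_of_real (focus a / Re z * (G z)\<^sup>2))" by simp
    then have "integrable (arc_length a) (\<lambda>z. focus a / Re z * (G z)\<^sup>2)"
      by (simp only: complex_of_real_integrable_eq)
    then show ?thesis by (subst integral_angle_measure(2)[OF a]) simp_all
  qed
  define L where "L N z = laurent_sum (inversion_coeff a M \<Phi>) N (disk_coord a z)" for N z
  have coeff: "inversion_coeff a M \<Phi> = U.fourier_coeff (\<lambda>z. of_real (G z))"
    unfolding G_def by (rule ext) (rule inversion_coeff_eq[OF a M g \<Phi>])
  define e where "e N z = (cmod (L N z - of_real (G z)))\<^sup>2" for N z
  have Gm: "(\<lambda>z. complex_of_real (G z)) \<in> borel_measurable (angle_measure a)"
    by (simp add: angle_measure_def)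
  have lim: "(\<lambda>N. LINT z|angle_measure a. e N z) \<longlonglongrightarrow> 0"
    unfolding e_def L_def coeff by (rule U.fourier_series_tendsto[OF Gm Gi])
  have ei: "integrable (angle_measure a) (e N)" for N
    unfolding e_def L_def by (intro integrable_square_diff U.integrable_square_laurent_sum Gi Gm) measurable
  have em [measurable]: "e N \<in> borel_measurable (arc_length a)" for N
    using borel_measurable_integrable[OF ei[of N]] by (simp add: angle_measure_def)
  have wi: "integrable (arc_length a) (\<lambda>z. focus a / Re z * e N z)" for N
    using ei[of N] unfolding integral_angle_measure(2)[OF a em] by simp
  have le: "e N z \<le> ((a + 1) / focus a) * (focus a / Re z * e N z)"
    if "z \<in> space (arc_length a)" for N z
  proof -
    have z: "z \<in> sphere (complex_of_real a) 1" using that by (simp add: space_arc_length)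
    have "1 \<le> (a + 1) / focus a * (focus a / Re z)"
      using circle_Re_bounds(2)[OF z] circle_Re_pos[OF a z] c by simp
    then have "1 * e N z \<le> ((a + 1) / focus a * (focus a / Re z)) * e N z"
      by (intro mult_right_mono) (auto simp: e_def)
    then show ?thesis by (simp only: mult.assoc mult_1)
  qed
  have ai: "integrable (arc_length a) (e N)" for N
  proof (rule Bochner_Integration.integrable_bound)
    show "integrable (arc_length a) (\<lambda>z. ((a + 1) / focus a) * (focus a / Re z * e N z))"
      using wi by (rule integrable_mult_right)
    show "AE z in arc_length a. norm (e N z) \<le> norm (((a + 1) / focus a) * (focus a / Re z * e N z))"
    proof (rule AE_I2)
      fix z assume z: "z \<in> space (arc_length a)"
      have "0 \<le> e N z" by (simp add: e_def)
      then show "norm (e N z) \<le> norm (((a + 1) / focus a) * (focus a / Re z * e N z))"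
        using le[OF z, of N] by (simp only: real_norm_def)
    qed
  qed (rule em)
  have "(\<lambda>N. LINT z|arc_length a. e N z) \<longlonglongrightarrow> 0"
  proof (rule tendsto_sandwich[OF _ _ tendsto_const])
    show "(\<lambda>N. ((a + 1) / focus a) * (LINT z|angle_measure a. e N z)) \<longlonglongrightarrow> 0"
      using tendsto_mult[OF tendsto_const lim, of "(a + 1) / focus a"] by simp
    show "\<forall>\<^sub>F N in sequentially. (LINT z|arc_length a. e N z) \<le> ((a + 1) / focus a) * (LINT z|angle_measure a. e N z)"
    proof (rule always_eventually, rule allI)
      fix N
      have "(LINT z|arc_length a. e N z) \<le> (LINT z|arc_length a. ((a + 1) / focus a) * (focus a / Re z * e N z))"
        using le by (intro integral_mono ai integrable_mult_right wi) auto
      also have "\<dots> = ((a + 1) / focus a) * (LINT z|arc_length a. focus a / Re z * e N z)"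
        by (rule integral_mult_right_zero)
      finally show "(LINT z|arc_length a. e N z) \<le> ((a + 1) / focus a) * (LINT z|angle_measure a. e N z)"
        unfolding integral_angle_measure(1)[OF a em] by simp
    qed
    show "\<forall>\<^sub>F N in sequentially. 0 \<le> (LINT z|arc_length a. e N z)"
      by (simp add: e_def)
  qed
  then have "L2_circle_tendsto a L G"
    using ai unfolding L2_circle_tendsto_def e_def by blast
  from L2_circle_tendsto_mult[OF this cont[of "int M - 2"]]
  show ?thesis
  proof (rule L2_circle_tendsto_cong)
    fix z assume z: "z \<in> sphere (complex_of_real a) 1"
    then have x: "Re z \<noteq> 0" using nz by blast
    show "inversion_series a M \<Phi> N z = of_real (Re z powi (int M - 2)) * L N z" for N
      by (simp add: inversion_series_def L_def laurent_sum_def disk_coord_def)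
    have "Re z powi (int M - 2) * Re z powi (2 - int M) = 1"
      using x by (simp flip: power_int_add)
    then show "g z = Re z powi (int M - 2) * G z" by (simp add: G_def flip: mult.assoc)
  qed
qed

section \<open>The data determine the transform\<close>

lemma kern_nonzero:
  assumes "k \<in> exterior_domain a" "z \<in> sphere (complex_of_real a) 1"
  shows "kern k z \<noteq> 0"
proof -
  have "k \<noteq> z" using assms by (auto simp: exterior_domain_def)
  moreover have "k \<noteq> - cnj z"
  proof
    assume k: "k = - cnj z"
    have "complex_of_real (- a) - k = - cnj (complex_of_real a - z)" by (simp add: k)
    then have "dist (complex_of_real (- a)) k = dist (complex_of_real a) z"
      unfolding dist_norm by (simp only: norm_minus_cancel complex_mod_cnj)
    then show False using assms by (auto simp: exterior_domain_def)
  qed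
  ultimately show ?thesis by (auto simp: kern_def eq_neg_iff_add_eq_0)
qed

lemma continuous_on_kern_powi:
  assumes "k \<in> exterior_domain a"
  shows "continuous_on (sphere (complex_of_real a) 1) (\<lambda>z. kern k z powi j)"
proof (intro continuous_intros)
  show "continuous_on (sphere (complex_of_real a) 1) (kern k)"
    unfolding kern_def by (intro continuous_intros)
qed (use kern_nonzero[OF assms] in auto)

lemma global_relation_split:
  assumes ut: "L2_circle a ut" and un: "L2_circle a un" and k: "k \<in> exterior_domain a"
  shows "(LINT z|arc_length a. kern k z powi j *
           ((k - \<i> * of_real (Im z)) * of_real (ut z) + \<i> * of_real (Re z) * of_real (un z)))
     = (LINT z|arc_length a. kern k z powi j * ((k - \<i> * of_real (Im z)) * of_real (ut z)))
       + \<i> * (LINT z|arc_length a. kern k z powi j * (of_real (Re z) * of_real (un z)))"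
proof -
  have 1: "integrable (arc_length a) (\<lambda>z. (kern k z powi j * (k - \<i> * of_real (Im z))) * of_real (ut z))"
    by (intro integrable_continuous_mult_L2[OF _ ut] continuous_intros continuous_on_kern_powi[OF k])
  have 2: "integrable (arc_length a) (\<lambda>z. (\<i> * (kern k z powi j * of_real (Re z))) * of_real (un z))"
    by (intro integrable_continuous_mult_L2[OF _ un] continuous_intros continuous_on_kern_powi[OF k])
  have "(LINT z|arc_length a. kern k z powi j *
           ((k - \<i> * of_real (Im z)) * of_real (ut z) + \<i> * of_real (Re z) * of_real (un z)))
     = (LINT z|arc_length a. (kern k z powi j * (k - \<i> * of_real (Im z))) * of_real (ut z)
         + (\<i> * (kern k z powi j * of_real (Re z))) * of_real (un z))"
    by (simp add: algebra_simps)
  also have "\<dots> = (LINT z|arc_length a. (kern k z powi j * (k - \<i> * of_real (Im z))) * of_real (ut z))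
     + (LINT z|arc_length a. (\<i> * (kern k z powi j * of_real (Re z))) * of_real (un z))"
    by (rule Bochner_Integration.integral_add[OF 1 2])
  also have "\<dots> = (LINT z|arc_length a. kern k z powi j * ((k - \<i> * of_real (Im z)) * of_real (ut z)))
       + \<i> * (LINT z|arc_length a. kern k z powi j * (of_real (Re z) * of_real (un z)))"
    by (simp only: mult.assoc integral_mult_right_zero)
  finally show ?thesis .
qed

lemma relation_data_eq:
  fixes m :: nat
  assumes ut: "L2_circle a ut" and un: "L2_circle a un"
    and rel: "global_relation a (- 2 * (int m - 1)) ut un" and k: "k \<in> exterior_domain a"
  shows "relation_data a (- 2 * (int m - 1)) ut k
    = (LINT z|arc_length a. of_real (Re z) * of_real (un z) / kern k z ^ m)"
proof -
  define j where "j = (- 2 * (int m - 1)) div 2 - 1"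
  have j: "j = - int m" unfolding j_def by simp
  let ?A = "LINT z|arc_length a. kern k z powi j * ((k - \<i> * of_real (Im z)) * of_real (ut z))"
  let ?B = "LINT z|arc_length a. kern k z powi j * (of_real (Re z) * of_real (un z))"
  have "?A + \<i> * ?B = 0"
    using rel k unfolding global_relation_def j_def[symmetric] global_relation_split[OF ut un k, symmetric] by blast
  then have "\<i> * ?A = ?B" by (simp add: complex_eq_iff)
  moreover have "?B = (LINT z|arc_length a. of_real (Re z) * of_real (un z) / kern k z ^ m)"
    by (rule Bochner_Integration.integral_cong) (simp_all add: j power_int_minus divide_inverse mult_ac)
  ultimately show ?thesis unfolding relation_data_def j_def[symmetric] by simp
qed

lemma normal_derivative_recovered:
  assumes a: "a > 1" and m: "m \<ge> 1" and "L2_circle a ut" "L2_circle a un"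
    and "global_relation a (- 2 * (int m - 1)) ut un"
  shows "L2_circle_tendsto a (recovered_normal_derivative a m ut) un"
  unfolding recovered_normal_derivative_def[abs_def]
  using inversion_series_tendsto[OF a m assms(4) relation_data_eq[OF assms(3-5)]] .

text \<open>As a function of the arc length parameter, \<open>u\<close> is an indefinite integral and hence continuous.
  The parametrization of the circle by a compact interval is a quotient map: the graph
  of \<open>u\<close> is the continuous image of this interval, hence closed, which gives continuity of \<open>u\<close>
  on the circle.\<close>

lemma has_tangential_derivative_continuous:
  assumes "has_tangential_derivative a u ut"
  shows "continuous_on (sphere (complex_of_real a) 1) u"
proof -
  define \<gamma> where "\<gamma> \<theta> = complex_of_real a + cis \<theta>" for \<theta>
  define U where "U \<theta> = u (\<gamma> \<theta>)" for \<theta>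
  have ut: "L2_circle a ut" using assms by (simp add: has_tangential_derivative_def)
  have si: "set_integrable lborel {0..2 * pi} (\<lambda>s. ut (\<gamma> s))"
  proof -
    have i: "integrable (arc_length a) ut" by (rule L2_circle_integrable[OF ut])
    then have "ut \<in> borel_measurable (restrict_space borel (sphere (complex_of_real a) 1))"
      using measurable_cong_sets[OF sets_arc_length refl] borel_measurable_integrable by blast
    then have "integrable (restrict_space lborel {0..<2 * pi}) (\<lambda>s. ut (\<gamma> s))"
      using i integrable_distr_eq[OF arc_parametrization_measurable]
      unfolding arc_length_def \<gamma>_def by blast
    then have "integrable lborel (\<lambda>s. indicator {0..<2 * pi} s *\<^sub>R ut (\<gamma> s))"
      by (subst (asm) integrable_restrict_space) auto
    moreover have "integrable lborel (\<lambda>s. indicator {0..<2 * pi} s *\<^sub>R ut (\<gamma> s))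
        \<longleftrightarrow> integrable lborel (\<lambda>s. indicator {0..2 * pi} s *\<^sub>R ut (\<gamma> s))"
      by (rule integrable_discrete_difference[of "{2 * pi}"]) (auto simp: indicator_def)
    ultimately show ?thesis by (simp add: set_integrable_def)
  qed
  have U: "U \<theta> = u (of_real a + 1) + integral {0..\<theta>} (\<lambda>s. ut (\<gamma> s))" if \<theta>: "\<theta> \<in> {0..2 * pi}" for \<theta>
  proof -
    have "set_integrable lborel {0..\<theta>} (\<lambda>s. ut (\<gamma> s))"
      by (rule set_integrable_subset[OF si]) (use \<theta> in auto)
    then have "(LINT s:{0..\<theta>}|lborel. ut (\<gamma> s)) = integral {0..\<theta>} (\<lambda>s. ut (\<gamma> s))"
      by (rule set_borel_integral_eq_integral(2))
    then show ?thesis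
      using assms \<theta> unfolding has_tangential_derivative_def U_def \<gamma>_def by auto
  qed
  have "continuous_on {0..2 * pi} (\<lambda>\<theta>. u (of_real a + 1) + integral {0..\<theta>} (\<lambda>s. ut (\<gamma> s)))"
    by (intro continuous_intros indefinite_integral_continuous_1 set_borel_integral_eq_integral(1)[OF si])
  then have Uc: "continuous_on {0..2 * pi} U" by (rule continuous_on_eq) (simp add: U)
  have \<gamma>c: "continuous_on {0..2 * pi} \<gamma>" unfolding \<gamma>_def by (intro continuous_intros)
  have sph: "sphere (complex_of_real a) 1 = \<gamma> ` {0..2 * pi}"
  proof
    show "\<gamma> ` {0..2 * pi} \<subseteq> sphere (complex_of_real a) 1" by (auto simp: \<gamma>_def dist_norm)
    show "sphere (complex_of_real a) 1 \<subseteq> \<gamma> ` {0..2 * pi}"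
    proof
      fix z assume "z \<in> sphere (complex_of_real a) 1"
      then have "cmod (z - of_real a) = 1" by (simp add: dist_norm norm_minus_commute)
      then have "z = \<gamma> (Arg2pi (z - of_real a))"
        using Arg2pi_eq[of "z - of_real a"] by (simp add: \<gamma>_def cis_conv_exp)
      then show "z \<in> \<gamma> ` {0..2 * pi}"
        using Arg2pi_ge_0[of "z - of_real a"] Arg2pi_lt_2pi[of "z - of_real a"] by (intro image_eqI) auto
    qed
  qed
  show ?thesis
  proof (rule continuous_from_closed_graph)
    show "compact (U ` {0..2 * pi})" by (rule compact_continuous_image[OF Uc compact_Icc])
    show "u \<in> sphere (complex_of_real a) 1 \<rightarrow> U ` {0..2 * pi}" unfolding sph by (auto simp: U_def)
    have "(\<lambda>z. (z, u z)) ` sphere (complex_of_real a) 1 = (\<lambda>\<theta>. (\<gamma> \<theta>, U \<theta>)) ` {0..2 * pi}"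
      unfolding sph by (auto simp: U_def)
    moreover have "compact ((\<lambda>\<theta>. (\<gamma> \<theta>, U \<theta>)) ` {0..2 * pi})"
      by (intro compact_continuous_image continuous_on_Pair \<gamma>c Uc compact_Icc)
    ultimately show "closed ((\<lambda>z. (z, u z)) ` sphere (complex_of_real a) 1)"
      by (simp add: compact_imp_closed)
  qed
qed

text \<open>Continuity makes the term with \<open>u\<close> integrable, so that the relation may be split.  The
  factor \<open>x powi (\<alpha> - 2) * x * x\<close> in front of \<open>un\<close> is \<open>x\<close> times \<open>x powi (\<alpha> - 1)\<close>.\<close>

lemma relation_data'_eq:
  fixes m :: nat
  assumes a: "a > 1" and u: "has_tangential_derivative a u ut" and un: "L2_circle a un"
    and rel: "global_relation' a (2 * (int m + 1)) u ut un" and k: "k \<in> exterior_domain a"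
  shows "relation_data' a (2 * (int m + 1)) u ut k
    = (LINT z|arc_length a. of_real (Re z) * of_real (Re z powi (2 * int m + 1) * un z) / kern k z ^ (m + 1))"
proof -
  define \<alpha> where "\<alpha> = 2 * (int m + 1)"
  have \<alpha>: "\<alpha> - 2 = 2 * int m" "\<alpha> div 2 = int (m + 1)" by (auto simp: \<alpha>_def)
  have ut: "L2_circle a ut" using u by (simp add: has_tangential_derivative_def)
  have uc: "continuous_on (sphere (complex_of_real a) 1) u" by (rule has_tangential_derivative_continuous[OF u])
  define W where "W z = of_real (Re z) powi (\<alpha> - 2) / kern k z powi (\<alpha> div 2)" for z
  have nz: "\<forall>z\<in>sphere (complex_of_real a) 1. complex_of_real (Re z) \<noteq> 0" using circle_Re_pos[OF a] by fastforce
  have W: "continuous_on (sphere (complex_of_real a) 1) W"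
    unfolding W_def using nz kern_nonzero[OF k]
    by (intro continuous_on_divide continuous_on_kern_powi[OF k] continuous_on_power_int continuous_intros) auto
  define V where "V z = of_int (\<alpha> - 1) * complex_of_real (u z) *
               ((k + cnj z) * dz_ds a z + (k - z) * dzbar_ds a z)" for z
  have V: "continuous_on (sphere (complex_of_real a) 1) V"
    unfolding V_def dz_ds_def dzbar_ds_def by (intro continuous_intros uc)
  define D where "D z = W z * (2 * of_real (Re z) * ((k - \<i> * of_real (Im z)) * of_real (ut z)) + V z)" for z
  have "integrable (arc_length a) (\<lambda>z. (W z * (2 * of_real (Re z) * (k - \<i> * of_real (Im z)))) * of_real (ut z))"
    by (intro integrable_continuous_mult_L2[OF _ ut] continuous_intros W)
  moreover have "integrable (arc_length a) (\<lambda>z. W z * V z)"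
    by (intro integrable_arc_continuous continuous_intros W V)
  ultimately have "integrable (arc_length a) (\<lambda>z. (W z * (2 * of_real (Re z) * (k - \<i> * of_real (Im z)))) * of_real (ut z) + W z * V z)"
    by (rule Bochner_Integration.integrable_add)
  then have Di: "integrable (arc_length a) D"
    by (simp add: D_def[abs_def] algebra_simps)
  define X where "X z = W z * (of_real (Re z) * of_real (Re z)) * of_real (un z)" for z
  have Xi: "integrable (arc_length a) X"
    unfolding X_def by (intro integrable_continuous_mult_L2[OF _ un] continuous_intros W)
  have "(LINT z|arc_length a. W z * (2 * of_real (Re z) *
              ((k - \<i> * of_real (Im z)) * of_real (ut z) + \<i> * of_real (Re z) * of_real (un z)) + V z)) = 0"
    using rel k unfolding global_relation'_def \<alpha>_def[symmetric] W_def V_def by blast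
  moreover have "(LINT z|arc_length a. W z * (2 * of_real (Re z) *
              ((k - \<i> * of_real (Im z)) * of_real (ut z) + \<i> * of_real (Re z) * of_real (un z)) + V z))
      = (LINT z|arc_length a. D z + 2 * \<i> * X z)"
    by (rule Bochner_Integration.integral_cong) (simp_all add: D_def X_def algebra_simps)
  moreover have "\<dots> = (LINT z|arc_length a. D z) + 2 * \<i> * (LINT z|arc_length a. X z)"
    using Di Xi by simp
  ultimately have "(LINT z|arc_length a. D z) = - (2 * \<i> * (LINT z|arc_length a. X z))"
    by (simp add: add_eq_0_iff2)
  then have "\<i> / 2 * (LINT z|arc_length a. D z) = (LINT z|arc_length a. X z)" by simp
  moreover have "relation_data' a \<alpha> u ut k = \<i> / 2 * (LINT z|arc_length a. D z)"
    unfolding relation_data'_def D_def V_def W_def ..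
  moreover have "(LINT z|arc_length a. X z)
      = (LINT z|arc_length a. of_real (Re z) * of_real (Re z powi (2 * int m + 1) * un z) / kern k z ^ (m + 1))"
  proof (rule Bochner_Integration.integral_cong[OF refl])
    fix z assume "z \<in> space (arc_length a)"
    then have x: "complex_of_real (Re z) \<noteq> 0" using nz by (simp add: space_arc_length)
    have "complex_of_real (Re z powi (2 * int m + 1)) = of_real (Re z) powi (2 * int m) * of_real (Re z)"
      using x by (simp add: power_int_add)
    moreover have "kern k z powi (\<alpha> div 2) = kern k z ^ (m + 1)"
      unfolding \<alpha> by (rule power_int_of_nat)
    ultimately show "X z = of_real (Re z) * of_real (Re z powi (2 * int m + 1) * un z) / kern k z ^ (m + 1)"
      by (simp add: X_def W_def \<alpha>(1) mult_ac)
  qed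
  ultimately show ?thesis by (simp add: \<alpha>_def)
qed

lemma normal_derivative_recovered':
  fixes m :: nat
  assumes a: "a > 1" and u: "has_tangential_derivative a u ut" and un: "L2_circle a un"
    and rel: "global_relation' a (2 * (int m + 1)) u ut un"
  shows "L2_circle_tendsto a (recovered_normal_derivative' a m u ut) un"
proof -
  have nz: "\<forall>z\<in>sphere (complex_of_real a) 1. Re z \<noteq> 0" using circle_Re_pos[OF a] by fastforce
  have c: "continuous_on (sphere (complex_of_real a) 1) (\<lambda>z. Re z powi j)" for j
    using nz by (intro continuous_intros) auto
  have g: "L2_circle a (\<lambda>z. Re z powi (2 * int m + 1) * un z)"
    by (rule L2_circle_continuous_mult[OF c un])
  have "L2_circle_tendsto a (inversion_series a (m + 1) (relation_data' a (2 * (int m + 1)) u ut))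
      (\<lambda>z. Re z powi (2 * int m + 1) * un z)"
    by (rule inversion_series_tendsto[OF a _ g]) (use relation_data'_eq[OF a u un rel] in auto)
  from L2_circle_tendsto_mult[OF this c[of "- (2 * int m + 1)"]]
  show ?thesis
  proof (rule L2_circle_tendsto_cong)
    fix z assume "z \<in> sphere (complex_of_real a) 1"
    then have x: "Re z \<noteq> 0" using nz by blast
    show "recovered_normal_derivative' a m u ut N z = of_real (Re z powi - (2 * int m + 1)) *
        inversion_series a (m + 1) (relation_data' a (2 * (int m + 1)) u ut) N z" for N
      by (simp only: recovered_normal_derivative'_def power_int_minus of_real_inverse of_real_power_int)
         (simp add: divide_inverse mult.commute)
    have "Re z powi - (2 * int m + 1) * Re z powi (2 * int m + 1) = 1"
      using x by (simp only: power_int_minus) simp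
    then show "un z = Re z powi - (2 * int m + 1) * (Re z powi (2 * int m + 1) * un z)"
      by (simp only: mult.assoc[symmetric] mult_1)
  qed
qed

section \<open>Non-uniqueness for positive parameters\<close>

lemma arc_length_moment:
  assumes "j \<noteq> (0::int)"
  shows "(LINT z|arc_length a. (z - of_real a) powi j) = 0"
proof -
  have nz: "z - of_real a \<noteq> 0" if "z \<in> sphere (complex_of_real a) 1" for z
    using that by auto
  have m: "(\<lambda>z. (z - of_real a) powi j) \<in> borel_measurable (arc_length a)"
    by (rule continuous_on_arc_measurable) (use nz in \<open>intro continuous_intros; auto\<close>)
  have "(LINT z|arc_length a. (z - of_real a) powi j) = (LINT t:{0..2 * pi}|lborel. cis (of_int j * t))"
    unfolding integral_arc_length[OF m] set_lebesgue_integral_def by (simp add: cis_power_int)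
  also have "\<dots> = 0"
    unfolding set_integral_angle_space using cis_moment[of j] assms by simp
  finally show ?thesis .
qed

text \<open>On the circle, \<open>e = z - a\<close> satisfies \<open>cnj e = 1 / e\<close>, so \<open>kern k z\<close> is a combination of \<open>1\<close>, \<open>e\<close>
  and \<open>1 / e\<close>.  Each factor \<open>kern k z\<close> thus moves the frequency by at most one.\<close>

lemma kern_power_moment:
  assumes "int p < \<bar>j\<bar>"
  shows "(LINT z|arc_length a. kern k z ^ p * (z - of_real a) powi j) = 0"
  using assms
proof (induction p arbitrary: j)
  case 0
  then show ?case by (simp add: arc_length_moment)
next
  case (Suc p)
  have nz: "z - of_real a \<noteq> 0" if "z \<in> sphere (complex_of_real a) 1" for z
    using that by auto
  define A B C where "A = k\<^sup>2 - of_real (a\<^sup>2) - 1" and "B = - (k + of_real a)" and "C = k - of_real a"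
  define T where "T i z = kern k z ^ p * (z - of_real a) powi i" for i z
  have Ti: "integrable (arc_length a) (T i)" for i
    unfolding T_def kern_def
    by (rule integrable_arc_continuous) (use nz in \<open>intro continuous_intros; auto\<close>)
  have "(LINT z|arc_length a. kern k z ^ Suc p * (z - of_real a) powi j)
      = (LINT z|arc_length a. A * T j z + B * T (j + 1) z + C * T (j - 1) z)"
  proof (rule Bochner_Integration.integral_cong[OF refl])
    fix z assume "z \<in> space (arc_length a)"
    then have z: "z \<in> sphere (complex_of_real a) 1" by (simp add: space_arc_length)
    define e where "e = z - of_real a"
    have e: "cmod e = 1" "e \<noteq> 0" using z nz[OF z] by (auto simp: e_def dist_norm norm_minus_commute)
    have "e * cnj e = 1" using e(1) by (simp add: complex_norm_square[symmetric])
    then have ce: "cnj e = 1 / e" using e(2) by (simp add: field_simps)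
    have "kern k z = (k - (of_real a + e)) * (k + of_real a + cnj e)"
      by (simp add: kern_def e_def)
    also have "\<dots> = A + B * e + C * (1 / e)"
      unfolding ce A_def B_def C_def using e(2) by (simp add: field_simps power2_eq_square)
    finally have "kern k z = A + B * e + C * (1 / e)" .
    moreover have "e powi (j + 1) = e powi j * e" "e powi (j - 1) = e powi j * (1 / e)"
      using e(2) by (simp_all add: power_int_add power_int_diff)
    ultimately show "kern k z ^ Suc p * (z - of_real a) powi j = A * T j z + B * T (j + 1) z + C * T (j - 1) z"
      unfolding T_def e_def[symmetric] by (simp add: algebra_simps)
  qed
  also have "\<dots> = A * (LINT z|arc_length a. T j z) + B * (LINT z|arc_length a. T (j + 1) z)
      + C * (LINT z|arc_length a. T (j - 1) z)"
    using Ti by simp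
  also have "\<dots> = 0"
    unfolding T_def using Suc.prems by (simp add: Suc.IH)
  finally show ?case .
qed

text \<open>In the angle around \<open>a\<close> this is \<open>cos ((m + 2) * \<theta>)\<close>; all functions \<open>kern k z ^ m * x\<close> have
  degree at most \<open>m + 1\<close> and are orthogonal to it.\<close>

definition silent_mode :: "real \<Rightarrow> nat \<Rightarrow> complex \<Rightarrow> real" where
  "silent_mode a m z = Re ((z - of_real a) ^ (m + 2))"

lemma silent_mode_powi:
  assumes "z \<in> sphere (complex_of_real a) 1"
  shows "complex_of_real (silent_mode a m z)
    = ((z - of_real a) powi (int m + 2) + (z - of_real a) powi (- (int m + 2))) / 2"
proof -
  have e: "cmod (z - of_real a) = 1" using assms by (simp add: dist_norm norm_minus_commute)
  have "(z - of_real a) powi (int m + 2) = (z - of_real a) ^ (m + 2)"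
    using power_int_of_nat[of "z - of_real a" "m + 2"] by (simp only: of_nat_add of_nat_numeral)
  then show ?thesis unfolding powi_minus_unit[OF e] silent_mode_def
    by (simp only: complex_add_cnj) simp
qed

lemma silent_mode_annihilated:
  "(LINT z|arc_length a. kern k z ^ m * (of_real (Re z) * of_real (silent_mode a m z))) = 0"
proof -
  have nz: "z - of_real a \<noteq> 0" if "z \<in> sphere (complex_of_real a) 1" for z
    using that by auto
  define T where "T i z = kern k z ^ m * (z - of_real a) powi i" for i z
  have Ti: "integrable (arc_length a) (T i)" for i
    unfolding T_def kern_def
    by (rule integrable_arc_continuous) (use nz in \<open>intro continuous_intros; auto\<close>)
  define N where "N = int m + 2"
  have "(LINT z|arc_length a. kern k z ^ m * (of_real (Re z) * of_real (silent_mode a m z)))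
     = (LINT z|arc_length a. of_real a / 2 * T N z + of_real a / 2 * T (- N) z
          + (1 / 4) * T (N + 1) z + (1 / 4) * T (N - 1) z + (1 / 4) * T (- N + 1) z + (1 / 4) * T (- N - 1) z)"
  proof (rule Bochner_Integration.integral_cong[OF refl])
    fix z assume "z \<in> space (arc_length a)"
    then have z: "z \<in> sphere (complex_of_real a) 1" by (simp add: space_arc_length)
    define e where "e = z - of_real a"
    have e: "cmod e = 1" "e \<noteq> 0" using z nz[OF z] by (auto simp: e_def dist_norm norm_minus_commute)
    have "e * cnj e = 1" using e(1) by (simp add: complex_norm_square[symmetric])
    then have ce: "cnj e = 1 / e" using e(2) by (simp add: field_simps)
    have "complex_of_real (Re z) = of_real a + (e + cnj e) / 2" by (simp add: e_def complex_eq_iff diff_divide_distrib)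
    then have x: "complex_of_real (Re z) = of_real a + (e + 1 / e) / 2" by (simp only: ce)
    have p: "e powi (i + 1) = e powi i * e" "e powi (i - 1) = e powi i * (1 / e)" for i
      using e(2) by (simp_all add: power_int_add power_int_diff)
    show "kern k z ^ m * (of_real (Re z) * of_real (silent_mode a m z))
        = of_real a / 2 * T N z + of_real a / 2 * T (- N) z
          + (1 / 4) * T (N + 1) z + (1 / 4) * T (N - 1) z + (1 / 4) * T (- N + 1) z + (1 / 4) * T (- N - 1) z"
      unfolding silent_mode_powi[OF z] T_def N_def[symmetric] e_def[symmetric] x p
      by (simp add: algebra_simps add_divide_distrib)
  qed
  also have "\<dots> = of_real a / 2 * integral\<^sup>L (arc_length a) (T N) + of_real a / 2 * integral\<^sup>L (arc_length a) (T (- N))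
          + (1 / 4) * integral\<^sup>L (arc_length a) (T (N + 1)) + (1 / 4) * integral\<^sup>L (arc_length a) (T (N - 1))
          + (1 / 4) * integral\<^sup>L (arc_length a) (T (- N + 1)) + (1 / 4) * integral\<^sup>L (arc_length a) (T (- N - 1))"
    using Ti by simp
  also have "\<dots> = 0"
  proof -
    have "integral\<^sup>L (arc_length a) (T i) = 0" if "int m < \<bar>i\<bar>" for i
      unfolding T_def by (rule kern_power_moment[OF that])
    then show ?thesis by (simp add: N_def)
  qed
  finally show ?thesis .
qed

lemma continuous_on_silent_mode: "continuous_on S (silent_mode a m)"
  unfolding silent_mode_def by (intro continuous_intros)

text \<open>The integral against \<open>(z - a) powi (m + 2)\<close> picks out one half of the circumference.\<close>

lemma silent_mode_not_AE_zero: "\<not> (AE z in arc_length a. silent_mode a m z = 0)"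
proof
  assume AE0: "AE z in arc_length a. silent_mode a m z = 0"
  interpret finite_measure "arc_length a" by (rule finite_measure_arc_length)
  have nz: "z - of_real a \<noteq> 0" if "z \<in> sphere (complex_of_real a) 1" for z
    using that by auto
  define N where "N = int m + 2"
  have i: "integrable (arc_length a) (\<lambda>z. (z - of_real a) powi i)" for i
    by (rule integrable_arc_continuous) (use nz in \<open>intro continuous_intros; auto\<close>)
  have "0 = (LINT z|arc_length a. (z - of_real a) powi N * of_real (silent_mode a m z))"
    by (rule integral_eq_zero_AE[symmetric]) (use AE0 in eventually_elim, simp)
  also have "\<dots> = (LINT z|arc_length a. (1 / 2) * (z - of_real a) powi (2 * N) + 1 / 2)"
  proof (rule Bochner_Integration.integral_cong[OF refl])
    fix z assume "z \<in> space (arc_length a)"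
    then have z: "z \<in> sphere (complex_of_real a) 1" by (simp add: space_arc_length)
    define P Q where "P = (z - of_real a) powi N" and "Q = (z - of_real a) powi (- N)"
    have "(z - of_real a) powi (N + N) = P * P"
      unfolding P_def by (rule power_int_add) (rule disjI1[OF nz[OF z]])
    then have PP: "(z - of_real a) powi (2 * N) = P * P" by (simp only: mult_2)
    have "P * Q = 1"
      unfolding P_def Q_def power_int_minus by (rule right_inverse) (use nz[OF z] in simp)
    then have "P * ((P + Q) / 2) = (1 / 2) * (P * P) + 1 / 2"
      by (simp add: distrib_left add_divide_distrib)
    then show "(z - of_real a) powi N * of_real (silent_mode a m z) = (1 / 2) * (z - of_real a) powi (2 * N) + 1 / 2"
      unfolding silent_mode_powi[OF z] N_def[symmetric] PP by (simp only: P_def Q_def)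
  qed
  also have "\<dots> = (1 / 2) * (LINT z|arc_length a. (z - of_real a) powi (2 * N)) + (LINT z|arc_length a. 1 / 2)"
    using i by simp
  also have "\<dots> = (LINT z|arc_length a. 1 / 2)"
    using arc_length_moment[of "2 * N" a] by (simp add: N_def)
  also have "\<dots> = (LINT t:{0..2 * pi}|lborel. 1 / 2)"
    unfolding set_lebesgue_integral_def by (rule integral_arc_length) simp
  also have "\<dots> = complex_of_real pi"
    by (simp add: set_lebesgue_integral_def scaleR_conv_of_real)
  finally show False by simp
qed

lemma global_relation_not_unique:
  fixes m :: nat
  assumes a: "a > 1" and ut: "L2_circle a ut" and un: "L2_circle a un"
    and rel: "global_relation a (2 * (int m + 1)) ut un"
  shows "\<exists>un'. L2_circle a un' \<and> global_relation a (2 * (int m + 1)) ut un' \<and>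
              \<not> (AE z in arc_length a. un' z = un z)"
proof (intro exI conjI)
  interpret finite_measure "arc_length a" by (rule finite_measure_arc_length)
  let ?h = "silent_mode a m"
  have h: "L2_circle a ?h"
    using L2_circle_continuous_mult[of a ?h "\<lambda>z. 1", OF continuous_on_silent_mode]
    by (simp add: L2_circle_def)
  have [measurable]: "un \<in> borel_measurable (arc_length a)" "?h \<in> borel_measurable (arc_length a)"
    by (intro L2_circle_measurable un h)+
  have "integrable (arc_length a) (\<lambda>z. (cmod (complex_of_real (un z) + of_real (?h z)))\<^sup>2)"
    by (rule integrable_square_add) (use un h in \<open>auto simp: L2_circle_def\<close>)
  then show new: "L2_circle a (\<lambda>z. un z + ?h z)"
    unfolding L2_circle_def by (simp flip: of_real_add)
  show "global_relation a (2 * (int m + 1)) ut (\<lambda>z. un z + ?h z)"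
    unfolding global_relation_def
  proof
    fix k assume k: "k \<in> exterior_domain a"
    define j where "j = 2 * (int m + 1) div 2 - 1"
    have j: "j = int m" by (simp add: j_def)
    have I: "integrable (arc_length a) (\<lambda>z. (kern k z powi j * of_real (Re z)) * of_real (g z))" if "L2_circle a g" for g
      by (intro integrable_continuous_mult_L2[OF _ that] continuous_intros continuous_on_kern_powi[OF k])
    have "(LINT z|arc_length a. kern k z powi j * (of_real (Re z) * of_real (un z + ?h z)))
      = (LINT z|arc_length a. kern k z powi j * of_real (Re z) * of_real (un z) + kern k z powi j * of_real (Re z) * of_real (?h z))"
      by (simp add: algebra_simps)
    also have "\<dots> = (LINT z|arc_length a. kern k z powi j * of_real (Re z) * of_real (un z))
        + (LINT z|arc_length a. kern k z powi j * of_real (Re z) * of_real (?h z))"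
      by (rule Bochner_Integration.integral_add[OF I[OF un] I[OF h]])
    also have "(LINT z|arc_length a. kern k z powi j * of_real (Re z) * of_real (?h z)) = 0"
      using silent_mode_annihilated[of a k m] by (simp add: j mult.assoc)
    finally have eq: "(LINT z|arc_length a. kern k z powi j * (of_real (Re z) * of_real (un z + ?h z)))
       = (LINT z|arc_length a. kern k z powi j * (of_real (Re z) * of_real (un z)))" by (simp add: mult.assoc)
    show "(LINT z|arc_length a. kern k z powi (2 * (int m + 1) div 2 - 1) *
           ((k - \<i> * of_real (Im z)) * of_real (ut z) + \<i> * of_real (Re z) * of_real (un z + ?h z))) = 0"
      using rel k
      unfolding global_relation_def j_def[symmetric] global_relation_split[OF ut new k] eq
        global_relation_split[OF ut un k, symmetric] by blast
  qed
  show "\<not> (AE z in arc_length a. un z + ?h z = un z)"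
    using silent_mode_not_AE_zero[of a m] by simp
qed

section \<open>Uniqueness and recovery of the normal derivative\<close>

theorem theorem1p5:
  fixes a :: real
  assumes "a > 1"
  shows
    "(\<forall>(m::nat) (\<alpha>::int). m \<ge> 1 \<and> \<alpha> = - 2 * (int m - 1) \<longrightarrow>
        (\<forall>ut un. L2_circle a ut \<and> L2_circle a un \<and> global_relation a \<alpha> ut un \<longrightarrow>
           (\<forall>un'. L2_circle a un' \<and> global_relation a \<alpha> ut un' \<longrightarrow>
              (AE z in arc_length a. un' z = un z)) \<and>
           L2_circle_tendsto a (recovered_normal_derivative a m ut) un)) \<and>
     (\<forall>(m::nat) (\<alpha>::int). \<alpha> = 2 * (int m + 1) \<longrightarrow>
        (\<forall>ut un. L2_circle a ut \<and> L2_circle a un \<and> global_relation a \<alpha> ut un \<longrightarrow>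
           (\<exists>un'. L2_circle a un' \<and> global_relation a \<alpha> ut un' \<and>
              \<not> (AE z in arc_length a. un' z = un z))) \<and>
        (\<forall>u ut un. has_tangential_derivative a u ut \<and> L2_circle a un \<and>
             global_relation' a \<alpha> u ut un \<longrightarrow>
           (\<forall>un'. L2_circle a un' \<and> global_relation' a \<alpha> u ut un' \<longrightarrow>
              (AE z in arc_length a. un' z = un z)) \<and>
           L2_circle_tendsto a (recovered_normal_derivative' a m u ut) un))"
proof (intro conjI allI impI; (elim conjE)?)
  fix m :: nat and \<alpha> :: int and ut un
  assume m: "m \<ge> 1" and \<alpha>: "\<alpha> = - 2 * (int m - 1)" and ut: "L2_circle a ut"
    and un: "L2_circle a un" and rel: "global_relation a \<alpha> ut un"
  show lim: "L2_circle_tendsto a (recovered_normal_derivative a m ut) un"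
    by (rule normal_derivative_recovered[OF assms m ut un rel[unfolded \<alpha>]])
  fix un' assume un': "L2_circle a un'" and rel': "global_relation a \<alpha> ut un'"
  show "AE z in arc_length a. un' z = un z"
    by (rule L2_circle_tendsto_unique[OF
          normal_derivative_recovered[OF assms m ut un' rel'[unfolded \<alpha>]] lim un' un])
next
  fix m :: nat and \<alpha> :: int and ut un
  assume \<alpha>: "\<alpha> = 2 * (int m + 1)" and ut: "L2_circle a ut"
    and un: "L2_circle a un" and rel: "global_relation a \<alpha> ut un"
  show "\<exists>un'. L2_circle a un' \<and> global_relation a \<alpha> ut un' \<and> \<not> (AE z in arc_length a. un' z = un z)"
    using global_relation_not_unique[OF assms ut un rel[unfolded \<alpha>]] by (simp only: \<alpha>)
next
  fix m :: nat and \<alpha> :: int and u ut un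
  assume \<alpha>: "\<alpha> = 2 * (int m + 1)" and u: "has_tangential_derivative a u ut"
    and un: "L2_circle a un" and rel: "global_relation' a \<alpha> u ut un"
  show lim: "L2_circle_tendsto a (recovered_normal_derivative' a m u ut) un"
    by (rule normal_derivative_recovered'[OF assms u un rel[unfolded \<alpha>]])
  fix un' assume un': "L2_circle a un'" and rel': "global_relation' a \<alpha> u ut un'"
  show "AE z in arc_length a. un' z = un z"
    by (rule L2_circle_tendsto_unique[OF
          normal_derivative_recovered'[OF assms u un' rel'[unfolded \<alpha>]] lim un' un])
qed

end
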